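(* Let $X,X_1,X_2,\ldots$ be iid random variables with cdf $F$ having a finite non-zero mean $\mu=\mathbb{E}(X)$, let $F_n$ be the empirical cdf and $\mu_n$ the arithmetic mean of $X_1,\dots,X_n$, and let $p\in(0,1)$. Let $$\mathrm{GC}(p)=\frac{1}{\mu}\left(\int_{1-p}^1 F^{-1}(u)\,du-\int_0^p F^{-1}(u)\,du\right),\qquad \mathrm{GC}_n(p)=\frac{1}{\mu_n}\left(\int_{1-p}^1 F_n^{-1}(u)\,du-\int_0^p F_n^{-1}(u)\,du\right) .$$ (1) $\mathrm{GC}_n(p)\stackrel{\mathbb{P}}{\to}\mathrm{GC}(p)$ as $n\to\infty$. (2) If in addition $\mathbb{E}(X^2)<\infty$ and the quantile function $F^{-1}$ is continuous at the points $p$ and $1-p$, then $$\sqrt{n}\,\big(\mathrm{GC}_n(p)-\mathrm{GC}(p)\big)\stackrel{d}{\to}\mathcal{N}(0,\sigma^2(p)),$$ where $\sigma^2(p)$ is the second moment of the mean-zero random variable $$Y(p)= \frac{1}{\mu } \int_{-\infty }^{F^{-1}(1-p)} \big( \mathbf{1}\{X\le x\} -F(x)\big)\, dx + \frac{1}{\mu } \int_{-\infty }^{F^{-1}(p)} \big( \mathbf{1}\{X\le x\} -F(x)\big)\, dx +\frac{1-\mathrm{GC}(p)}{\mu } \big( X-\mu \big) .$$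
   Context: The quantile function of a cdf $F$ is $F^{-1}(u)=\inf\{x\in\mathbb{R}: F(x)\ge u\}$ for $u\in(0,1]$ and $F^{-1}(0)=\lim_{u\downarrow 0}F^{-1}(u)$. The empirical cdf is $F_n(x)=\frac1n\sum_{i=1}^n\mathbf{1}\{X_i\le x\}$, with quantile function $F_n^{-1}$ defined in the same way; $\mu_n=\frac1n\sum_{i=1}^nX_i=\int_0^1F_n^{-1}(u)\,du$ (the event $\mu_n=0$ has probability tending to $0$, so the value assigned to $\mathrm{GC}_n(p)$ on it is immaterial). $\stackrel{\mathbb{P}}{\to}$ and $\stackrel{d}{\to}$ denote convergence in probability and in distribution; $\mathcal{N}(0,\sigma^2)$ is the normal distribution (degenerate at $0$ if $\sigma^2=0$). *)

theory Defs
  imports "HOL-Probability.Probability"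
begin

text \<open>
  Quantile functions are extended-real-valued: at \<open>0\<close> and \<open>1\<close> the defining limit and infimum
  may be \<open>-\<infinity>\<close> and \<open>\<infinity>\<close>. On \<open>(0,1)\<close> the quantile function of a cdf is
  finite, so \<open>real_of_ereal\<close> in \<open>GC\<close> below loses nothing. Only arguments in
  \<open>[0,1]\<close> are meaningful.
\<close>

definition quantile :: "(real \<Rightarrow> real) \<Rightarrow> real \<Rightarrow> ereal" where
  "quantile F u =
     (if u = 0 then Lim (at_right 0) (\<lambda>v. INF x\<in>{x. v \<le> F x}. ereal x)
      else (INF x\<in>{x. u \<le> F x}. ereal x))"

definition empirical_cdf :: "(nat \<Rightarrow> 'a \<Rightarrow> real) \<Rightarrow> nat \<Rightarrow> 'a \<Rightarrow> real \<Rightarrow> real" where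
  "empirical_cdf X n \<omega> x = 1 / real n * (\<Sum>i=1..n. of_bool (X i \<omega> \<le> x))"

definition sample_mean :: "(nat \<Rightarrow> 'a \<Rightarrow> real) \<Rightarrow> nat \<Rightarrow> 'a \<Rightarrow> real" where
  "sample_mean X n \<omega> = 1 / real n * (\<Sum>i=1..n. X i \<omega>)"

text \<open>The second argument is the mean of the distribution with cdf \<open>F\<close>.\<close>

definition GC :: "(real \<Rightarrow> real) \<Rightarrow> real \<Rightarrow> real \<Rightarrow> real" where
  "GC F m p = 1 / m *
     ((LBINT u=ereal (1 - p)..1. real_of_ereal (quantile F u))
      - (LBINT u=0..ereal p. real_of_ereal (quantile F u)))"

text \<open>Where the sample mean is \<open>0\<close>, this is \<open>0\<close> because \<open>1 / 0 = 0\<close>.\<close>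

definition empirical_GC :: "(nat \<Rightarrow> 'a \<Rightarrow> real) \<Rightarrow> nat \<Rightarrow> real \<Rightarrow> 'a \<Rightarrow> real" where
  "empirical_GC X n p \<omega> = GC (empirical_cdf X n \<omega>) (sample_mean X n \<omega>) p"

text \<open>The value of the random variable \<open>Y(p)\<close> on the event \<open>X = x\<close>.\<close>

definition GC_influence :: "(real \<Rightarrow> real) \<Rightarrow> real \<Rightarrow> real \<Rightarrow> real \<Rightarrow> real" where
  "GC_influence F m p x =
     1 / m * (LBINT t=-\<infinity>..quantile F (1 - p). of_bool (x \<le> t) - F t)
     + 1 / m * (LBINT t=-\<infinity>..quantile F p. of_bool (x \<le> t) - F t)
     + (1 - GC F m p) / m * (x - m)"

text \<open>
  Both modes of convergence require measurability explicitly, since \<open>measure\<close> and \<open>distr\<close>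
  return junk values on non-measurable arguments.
\<close>

definition tendsto_in_probability ::
    "'a measure \<Rightarrow> (nat \<Rightarrow> 'a \<Rightarrow> real) \<Rightarrow> ('a \<Rightarrow> real) \<Rightarrow> bool" where
  "tendsto_in_probability M Z W \<longleftrightarrow>
     (\<forall>n. Z n \<in> borel_measurable M) \<and> W \<in> borel_measurable M \<and>
     (\<forall>\<epsilon>>0. (\<lambda>n. measure M {\<omega> \<in> space M. \<bar>Z n \<omega> - W \<omega>\<bar> > \<epsilon>}) \<longlonglongrightarrow> 0)"

definition tendsto_in_distribution ::
    "'a measure \<Rightarrow> (nat \<Rightarrow> 'a \<Rightarrow> real) \<Rightarrow> real measure \<Rightarrow> bool" where
  "tendsto_in_distribution M Z N \<longleftrightarrow>
     (\<forall>n. Z n \<in> borel_measurable M) \<and> weak_conv_m (\<lambda>n. distr M borel (Z n)) N"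

text \<open>The parameters are the mean and the variance.\<close>

definition normal_distribution :: "real \<Rightarrow> real \<Rightarrow> real measure" where
  "normal_distribution m v =
     (if v = 0 then return borel m
      else density lborel (\<lambda>x. ennreal (normal_density m (sqrt v) x)))"

end

theory Submission
  imports Defs
begin

text \<open>
  The key is the variational formula
  \<open>L(p) = \<integral>\<^bsub>(0,p)\<^esub> F\<^sup>-\<^sup>1 = max\<^sub>x (p x - E(x - X)\<^sup>+)\<close>, whose maximum is attained at
  \<open>F\<^sup>-\<^sup>1(p)\<close>, together with \<open>E(x - X)\<^sup>+ = \<integral>\<^bsub>t<x\<^esub> F(t) dt\<close>; and
  \<open>GC(p) = 1 - (L(p) + L(1 - p)) / \<mu>\<close>.

  Hence \<open>L\<close> and \<open>\<mu>\<close> are Lipschitz in \<open>F\<close> with respect to \<open>\<integral>|F\<^sub>n - F|\<close>, whose expectation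
  tends to \<open>0\<close> by dominated convergence; this gives (1).

  For (2), put \<open>q = F\<^sup>-\<^sup>1(p)\<close>. Then \<open>L\<^sub>n(p)\<close> exceeds \<open>p q - E\<^sub>n(q - X)\<^sup>+\<close>, a sample mean, by at
  most the integral of \<open>(p - F\<^sub>n)\<^sup>+\<close> over \<open>t > q\<close> and of \<open>(F\<^sub>n - p)\<^sup>+\<close> over \<open>t < q\<close>. As
  \<open>F\<^sup>-\<^sup>1\<close> is continuous at \<open>p\<close>, \<open>F(t) - p\<close> has strict sign on either side of \<open>q\<close>, so both
  integrands are at most \<open>min(|F\<^sub>n - F|, (F\<^sub>n - F)\<^sup>2 / |F - p|)\<close>, and \<open>\<surd>n\<close> times the expected
  integral tends to \<open>0\<close>. The central limit theorem and Slutsky's theorem finish the proof.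
\<close>

section \<open>Distribution functions and quantiles\<close>

text \<open>Tonelli on the region \<open>y <= t < x\<close> under the product of \<open>N\<close>
  and Lebesgue measure: the slice at \<open>t\<close> has mass \<open>cdf N t\<close>, the slice at
  \<open>y\<close> has length \<open>x - y\<close>. As \<open>ennreal\<close> sends negative reals
  to 0, the right-hand side is the mean of a positive part.\<close>

lemma nn_integral_cdf_lessThan:
  assumes "real_distribution N"
  shows "(\<integral>\<^sup>+t. ennreal (cdf N t) * indicator {..<x} t \<partial>lborel) = (\<integral>\<^sup>+y. ennreal (x - y) \<partial>N)"
proof -
  interpret real_distribution N by fact
  interpret P: pair_sigma_finite N lborel ..
  let ?S = "{z::real \<times> real. fst z \<le> snd z \<and> snd z < x}"
  have "(\<integral>\<^sup>+t. ennreal (cdf N t) * indicator {..<x} t \<partial>lborel)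
      = (\<integral>\<^sup>+t. (\<integral>\<^sup>+y. indicator ?S (y, t) \<partial>N) \<partial>lborel)"
  proof (rule nn_integral_cong)
    fix t
    have "(\<integral>\<^sup>+y. indicator ?S (y, t) \<partial>N) = (\<integral>\<^sup>+y. indicator {..t} y * indicator {..<x} t \<partial>N)"
      by (intro nn_integral_cong) (auto split: split_indicator)
    also have "\<dots> = ennreal (cdf N t) * indicator {..<x} t"
      by (simp add: nn_integral_multc cdf_def emeasure_eq_measure)
    finally show "ennreal (cdf N t) * indicator {..<x} t = (\<integral>\<^sup>+y. indicator ?S (y, t) \<partial>N)" ..
  qed
  also have "\<dots> = (\<integral>\<^sup>+y. (\<integral>\<^sup>+t. indicator ?S (y, t) \<partial>lborel) \<partial>N)"
    by (rule P.Fubini') (simp, measurable)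
  also have "\<dots> = (\<integral>\<^sup>+y. ennreal (x - y) \<partial>N)"
  proof (rule nn_integral_cong)
    fix y
    have "(\<integral>\<^sup>+t. indicator ?S (y, t) \<partial>lborel) = (\<integral>\<^sup>+t. indicator {y..<x} t \<partial>lborel)"
      by (intro nn_integral_cong) (auto split: split_indicator)
    then show "(\<integral>\<^sup>+t. indicator ?S (y, t) \<partial>lborel) = ennreal (x - y)"
      by (cases "y \<le> x") (simp_all add: ennreal_neg)
  qed
  finally show ?thesis .
qed

text \<open>The same argument on the region \<open>x <= t < y\<close>, whose slice at
  \<open>t\<close> has mass \<open>1 - cdf N t\<close>. Both half-line integrals later supply
  integrable majorants for dominated convergence.\<close>

lemma nn_integral_cdf_atLeast:
  assumes "real_distribution N"
  shows "(\<integral>\<^sup>+t. ennreal (1 - cdf N t) * indicator {x..} t \<partial>lborel) = (\<integral>\<^sup>+y. ennreal (y - x) \<partial>N)"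
proof -
  interpret real_distribution N by fact
  interpret P: pair_sigma_finite N lborel ..
  let ?S = "{z::real \<times> real. snd z < fst z \<and> x \<le> snd z}"
  have "(\<integral>\<^sup>+t. ennreal (1 - cdf N t) * indicator {x..} t \<partial>lborel)
      = (\<integral>\<^sup>+t. (\<integral>\<^sup>+y. indicator ?S (y, t) \<partial>N) \<partial>lborel)"
  proof (rule nn_integral_cong)
    fix t
    have "measure N {t<..} = 1 - cdf N t"
      using prob_compl[of "{..t}"] by (simp add: cdf_def Compl_eq_Diff_UNIV[symmetric])
    moreover have "(\<integral>\<^sup>+y. indicator ?S (y, t) \<partial>N) = (\<integral>\<^sup>+y. indicator {t<..} y * indicator {x..} t \<partial>N)"
      by (intro nn_integral_cong) (auto split: split_indicator)
    ultimately show "ennreal (1 - cdf N t) * indicator {x..} t = (\<integral>\<^sup>+y. indicator ?S (y, t) \<partial>N)"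
      by (simp add: nn_integral_multc emeasure_eq_measure)
  qed
  also have "\<dots> = (\<integral>\<^sup>+y. (\<integral>\<^sup>+t. indicator ?S (y, t) \<partial>lborel) \<partial>N)"
    by (rule P.Fubini') (simp, measurable)
  also have "\<dots> = (\<integral>\<^sup>+y. ennreal (y - x) \<partial>N)"
  proof (rule nn_integral_cong)
    fix y
    have "(\<integral>\<^sup>+t. indicator ?S (y, t) \<partial>lborel) = (\<integral>\<^sup>+t. indicator {x..<y} t \<partial>lborel)"
      by (intro nn_integral_cong) (auto split: split_indicator)
    then show "(\<integral>\<^sup>+t. indicator ?S (y, t) \<partial>lborel) = ennreal (y - x)"
      by (cases "x \<le> y") (simp_all add: ennreal_neg)
  qed
  finally show ?thesis .
qed

lemma borel_measurable_cdf [measurable]: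
  assumes "real_distribution N"
  shows "cdf N \<in> borel_measurable borel"
proof -
  interpret cdf_distribution N using assms by (simp add: cdf_distribution_def)
  show ?thesis by measurable
qed

text \<open>A finite first moment makes the mean of the positive part finite, which turns the
  identity of nonnegative integrals into one of Bochner integrals.\<close>

lemma
  assumes "real_distribution N" and "integrable N (\<lambda>y. y)"
  shows integrable_cdf_lessThan: "integrable lborel (\<lambda>t. indicator {..<x} t * cdf N t)" (is ?A)
    and integral_cdf_lessThan:
      "(\<integral>t. indicator {..<x} t * cdf N t \<partial>lborel) = (\<integral>y. max 0 (x - y) \<partial>N)" (is ?B)
proof -
  interpret real_distribution N by fact
  have [measurable]: "cdf N \<in> borel_measurable borel" using assms(1) by (rule borel_measurable_cdf)
  have int: "integrable N (\<lambda>y. max 0 (x - y))"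
    using assms(2) by (intro integrable_max) auto
  have "(\<integral>\<^sup>+t. ennreal (indicator {..<x} t * cdf N t) \<partial>lborel) = (\<integral>\<^sup>+y. ennreal (max 0 (x - y)) \<partial>N)"
  proof -
    have "ennreal (indicator {..<x} t * cdf N t) = ennreal (cdf N t) * indicator {..<x} t" for t
      by (simp split: split_indicator)
    moreover have "ennreal (max 0 (x - y)) = ennreal (x - y)" for y
      by (simp add: max_def ennreal_neg)
    ultimately show ?thesis
      using nn_integral_cdf_lessThan[OF assms(1), of x] by simp
  qed
  also have "\<dots> = ennreal (\<integral>y. max 0 (x - y) \<partial>N)"
    using int by (intro nn_integral_eq_integral) auto
  finally have "has_bochner_integral lborel (\<lambda>t. indicator {..<x} t * cdf N t) (\<integral>y. max 0 (x - y) \<partial>N)"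
    by (intro has_bochner_integral_nn_integral) (auto simp: cdf_nonneg intro!: integral_nonneg_AE)
  then show ?A ?B
    by (auto simp: has_bochner_integral_iff)
qed

lemma
  assumes "real_distribution N" and "integrable N (\<lambda>y. y)"
  shows integrable_cdf_atLeast: "integrable lborel (\<lambda>t. indicator {x..} t * (1 - cdf N t))" (is ?A)
    and integral_cdf_atLeast:
      "(\<integral>t. indicator {x..} t * (1 - cdf N t) \<partial>lborel) = (\<integral>y. max 0 (y - x) \<partial>N)" (is ?B)
proof -
  interpret real_distribution N by fact
  have [measurable]: "cdf N \<in> borel_measurable borel" using assms(1) by (rule borel_measurable_cdf)
  have int: "integrable N (\<lambda>y. max 0 (y - x))"
    using assms(2) by (intro integrable_max) auto
  have "(\<integral>\<^sup>+t. ennreal (indicator {x..} t * (1 - cdf N t)) \<partial>lborel) = (\<integral>\<^sup>+y. ennreal (max 0 (y - x)) \<partial>N)"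
  proof -
    have "ennreal (indicator {x..} t * (1 - cdf N t)) = ennreal (1 - cdf N t) * indicator {x..} t" for t
      by (simp split: split_indicator)
    moreover have "ennreal (max 0 (y - x)) = ennreal (y - x)" for y
      by (simp add: max_def ennreal_neg)
    ultimately show ?thesis
      using nn_integral_cdf_atLeast[OF assms(1), of x] by simp
  qed
  also have "\<dots> = ennreal (\<integral>y. max 0 (y - x) \<partial>N)"
    using int by (intro nn_integral_eq_integral) auto
  finally have "has_bochner_integral lborel (\<lambda>t. indicator {x..} t * (1 - cdf N t)) (\<integral>y. max 0 (y - x) \<partial>N)"
    by (intro has_bochner_integral_nn_integral)
      (auto simp: cdf_bounded_prob intro!: integral_nonneg_AE AE_I2 mult_nonneg_nonneg)
  then show ?A ?B
    by (auto simp: has_bochner_integral_iff)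
qed

section \<open>Quantiles as generalised inverses, and the quantile transform\<close>

text \<open>The extended real infimum is the real one once the set is nonempty and bounded below.
  The pseudoinverse \<open>I u\<close> of the library gives both: it bounds the set from below and
  belongs to it.\<close>

lemma quantile_cdf_eq:
  assumes "real_distribution N" "0 < u" "u < 1"
  shows "quantile (cdf N) u = ereal (Inf {x. u \<le> cdf N x})"
proof -
  interpret cdf_distribution N using assms(1) by (simp add: cdf_distribution_def)
  have iff: "u \<le> C x \<longleftrightarrow> I u \<le> x" for x
    using assms by (intro pseudoinverse)
  have "ereal (Inf {x. u \<le> cdf N x}) = (INF x\<in>{x. u \<le> cdf N x}. ereal x)"
  proof (rule ereal_Inf')
    show "bdd_below {x. u \<le> C x}"
      using iff by (intro bdd_belowI[of _ "I u"]) blast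
    have "I u \<in> {x. u \<le> C x}"
      using iff by blast
    then show "{x. u \<le> C x} \<noteq> {}" by blast
  qed
  with assms show ?thesis by (simp add: quantile_def)
qed

text \<open>Later comparisons of a quantile with a point go through this Galois connection.\<close>

lemma quantile_cdf_le_iff:
  assumes "real_distribution N" "0 < u" "u < 1"
  shows "real_of_ereal (quantile (cdf N) u) \<le> x \<longleftrightarrow> u \<le> cdf N x"
proof -
  interpret cdf_distribution N using assms(1) by (simp add: cdf_distribution_def)
  show ?thesis
    using pseudoinverse[of u x] assms by (simp add: quantile_cdf_eq)
qed

text \<open>This is the quantile transform. The library has it for \<open>I\<close>, and on the open
  unit interval \<open>I\<close> is the quantile function.\<close>

lemma
  assumes "real_distribution N"
  shows measurable_quantile_cdf:
      "(\<lambda>u. real_of_ereal (quantile (cdf N) u)) \<in> borel_measurable (restrict_space lborel {0<..<1})"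
      (is ?meas)
    and distr_quantile_cdf:
      "distr (restrict_space lborel {0<..<1}) borel (\<lambda>u. real_of_ereal (quantile (cdf N) u)) = N"
      (is ?distr)
proof -
  interpret cdf_distribution N using assms(1) by (simp add: cdf_distribution_def)
  have eq: "real_of_ereal (quantile (cdf N) u) = I u" if "u \<in> {0<..<1}" for u
    using that by (simp add: quantile_cdf_eq assms)
  have "I \<in> borel_measurable (restrict_space lborel {0<..<1})"
    using measurable_CI by (simp cong: measurable_cong_sets sets_restrict_space_cong)
  then show ?meas
    by (rule measurable_cong[THEN iffD1, rotated]) (auto simp: eq space_restrict_space)
  have "distr (restrict_space lborel {0<..<1}) borel (\<lambda>u. real_of_ereal (quantile (cdf N) u))
      = distr (restrict_space lborel {0<..<1}) borel I"
    by (rule distr_cong) (auto simp: eq space_restrict_space)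
  then show ?distr
    using distr_I_eq_M by simp
qed

lemma
  fixes f :: "real \<Rightarrow> real"
  assumes N: "real_distribution N" and f: "integrable N f"
  shows set_integrable_quantile_cdf:
      "set_integrable lborel {0<..<1} (\<lambda>u. f (real_of_ereal (quantile (cdf N) u)))" (is ?A)
    and set_integral_quantile_cdf:
      "(LINT u:{0<..<1}|lborel. f (real_of_ereal (quantile (cdf N) u))) = (\<integral>y. f y \<partial>N)" (is ?B)
proof -
  interpret real_distribution N by fact
  have [measurable]: "f \<in> borel_measurable borel"
    using borel_measurable_integrable[OF f] by simp
  note [measurable] = measurable_quantile_cdf[OF N]
  have "integrable (restrict_space lborel {0<..<1}) (\<lambda>u. f (real_of_ereal (quantile (cdf N) u)))"
    using f by (subst (asm) distr_quantile_cdf[OF N, symmetric], subst (asm) integrable_distr_eq) auto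
  then show ?A
    by (simp add: set_integrable_def integrable_restrict_space)
  have "(\<integral>y. f y \<partial>N) = (\<integral>u. f (real_of_ereal (quantile (cdf N) u)) \<partial>restrict_space lborel {0<..<1})"
    by (subst distr_quantile_cdf[OF N, symmetric], subst integral_distr) auto
  then show ?B
    by (simp add: set_lebesgue_integral_def integral_restrict_space)
qed

lemma integrable_indicator_bounded:
  fixes A :: "real set"
  assumes "A \<in> sets borel" "bounded A"
  shows "integrable lborel (indicator A :: real \<Rightarrow> real)"
  using assms by (intro integrable_real_indicator emeasure_bounded_finite) auto

section \<open>The lower tail integral of the quantile function and its variational formula\<close>

text \<open>The generalised Lorenz curve; divided by the mean it is the Lorenz curve of
  \<open>N\<close>.\<close>

definition lower_tail :: "real measure \<Rightarrow> real \<Rightarrow> real" where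
  "lower_tail N p = (LBINT u=0..ereal p. real_of_ereal (quantile (cdf N) u))"

context
  fixes N :: "real measure" and p :: real
  assumes N: "real_distribution N" and int: "integrable N (\<lambda>y. y)" and p: "0 < p" "p < 1"
begin

lemma lower_tail_eq_set_integral:
  "lower_tail N p = (LINT u:{0<..<p}|lborel. real_of_ereal (quantile (cdf N) u))"
  using p by (simp add: lower_tail_def zero_ereal_def interval_integral_Ioo)

lemma integrable_max_distribution: "integrable N (\<lambda>y. max 0 (x - y))"
proof -
  interpret real_distribution N by (rule N)
  show ?thesis using int by (intro integrable_max) auto
qed

lemma set_integrable_quantile:
  "A \<in> sets borel \<Longrightarrow> A \<subseteq> {0<..<1} \<Longrightarrow> set_integrable lborel A (\<lambda>u. real_of_ereal (quantile (cdf N) u))"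
  by (rule set_integrable_subset[OF set_integrable_quantile_cdf[OF N int]]) auto

lemma set_integral_minus_quantile:
  "(LINT u:{0<..<p}|lborel. x - real_of_ereal (quantile (cdf N) u)) = p * x - lower_tail N p"
proof -
  have "set_integrable lborel {0<..<p} (\<lambda>u. x)"
    by (simp add: set_integrable_def integrable_indicator_bounded)
  moreover have "set_integrable lborel {0<..<p} (\<lambda>u. real_of_ereal (quantile (cdf N) u))"
    using p by (intro set_integrable_quantile) auto
  moreover have "(LINT u:{0<..<p}|lborel. x) = p * x"
    using p by (simp add: set_lebesgue_integral_def)
  ultimately show ?thesis
    by (simp add: lower_tail_eq_set_integral set_integral_diff)
qed

text \<open>The integrand \<open>x - F^-1(u)\<close> is at most its positive part, and the integral
  of the latter only grows when extended from \<open>(0,p)\<close> to \<open>(0,1)\<close>, where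
  the quantile transform turns it into a mean under \<open>N\<close>.\<close>

lemma lower_tail_ge: "p * x - (\<integral>y. max 0 (x - y) \<partial>N) \<le> lower_tail N p"
proof -
  have int1: "set_integrable lborel {0<..<p} (\<lambda>u. x - real_of_ereal (quantile (cdf N) u))"
    using p by (intro set_integral_diff set_integrable_quantile) (auto simp: set_integrable_def integrable_indicator_bounded)
  have int2: "set_integrable lborel {0<..<1} (\<lambda>u. max 0 (x - real_of_ereal (quantile (cdf N) u)))"
    by (rule set_integrable_quantile_cdf[OF N integrable_max_distribution])
  have "(LINT u:{0<..<p}|lborel. x - real_of_ereal (quantile (cdf N) u))
     \<le> (LINT u:{0<..<1}|lborel. max 0 (x - real_of_ereal (quantile (cdf N) u)))"
    unfolding set_lebesgue_integral_def
    using int1 int2 p unfolding set_integrable_def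
    by (intro integral_mono) (auto split: split_indicator)
  also have "\<dots> = (\<integral>y. max 0 (x - y) \<partial>N)"
    by (rule set_integral_quantile_cdf[OF N integrable_max_distribution])
  finally show ?thesis
    by (simp add: set_integral_minus_quantile)
qed

text \<open>At \<open>x = q\<close> both estimates behind \<open>lower_tail_ge\<close> are
  equalities: the quantile function is monotone, so \<open>q - F^-1(u)\<close> is nonnegative for
  \<open>u <= p\<close> and nonpositive for \<open>u >= p\<close>, and its positive part on
  \<open>(0,1)\<close> is its restriction to \<open>(0,p)\<close>.\<close>

lemma lower_tail_eq:
  defines "q \<equiv> real_of_ereal (quantile (cdf N) p)"
  shows "lower_tail N p = p * q - (\<integral>y. max 0 (q - y) \<partial>N)"
proof -
  interpret real_distribution N by (rule N)
  have *: "indicator {0<..<p} u *\<^sub>R (q - real_of_ereal (quantile (cdf N) u))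
      = indicator {0<..<1} u *\<^sub>R max 0 (q - real_of_ereal (quantile (cdf N) u))" for u
  proof (cases "0 < u \<and> u < 1")
    case True
    have "u \<le> p \<Longrightarrow> real_of_ereal (quantile (cdf N) u) \<le> q"
      using quantile_cdf_le_iff[OF N, of u q] quantile_cdf_le_iff[OF N p, of q] True by (simp add: q_def)
    moreover have "p \<le> u \<Longrightarrow> q \<le> real_of_ereal (quantile (cdf N) u)"
      using quantile_cdf_le_iff[OF N, of u "real_of_ereal (quantile (cdf N) u)"]
        quantile_cdf_le_iff[OF N p] True
      by (simp add: q_def)
    ultimately show ?thesis
      using True p by (auto split: split_indicator)
  qed (use p in \<open>auto split: split_indicator\<close>)
  have "(LINT u:{0<..<p}|lborel. q - real_of_ereal (quantile (cdf N) u))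
     = (LINT u:{0<..<1}|lborel. max 0 (q - real_of_ereal (quantile (cdf N) u)))"
    unfolding set_lebesgue_integral_def * ..
  also have "\<dots> = (\<integral>y. max 0 (q - y) \<partial>N)"
    by (rule set_integral_quantile_cdf[OF N integrable_max_distribution])
  finally show ?thesis
    by (simp add: set_integral_minus_quantile)
qed

lemma upper_tail_eq:
  "(LBINT u=ereal p..1. real_of_ereal (quantile (cdf N) u)) = (\<integral>y. y \<partial>N) - lower_tail N p"
proof -
  let ?Q = "\<lambda>u. real_of_ereal (quantile (cdf N) u)"
  have eq: "{0<..<1} = {0<..<p} \<union> {p..<1}" using p by auto
  have "(\<integral>y. y \<partial>N) = (LINT u:{0<..<1}|lborel. ?Q u)"
    by (rule set_integral_quantile_cdf[OF N int, symmetric])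
  also have "\<dots> = (LINT u:{0<..<p}|lborel. ?Q u) + (LINT u:{p..<1}|lborel. ?Q u)"
    unfolding eq using p by (intro set_integral_Un set_integrable_quantile) auto
  \<comment> \<open>The partition of \<open>(0,1)\<close> leaves a half-open interval, the interval
    integral an open one; they differ by the null set \<open>{p}\<close>.\<close>
  also have "(LINT u:{p..<1}|lborel. ?Q u) = (LINT u:{p<..<1}|lborel. ?Q u)"
    unfolding set_lebesgue_integral_def
  proof (rule integral_cong_AE)
    have "set_integrable lborel {p..<1} ?Q" "set_integrable lborel {p<..<1} ?Q"
      using p by (auto intro!: set_integrable_quantile)
    then show "(\<lambda>u. indicat_real {p..<1} u *\<^sub>R ?Q u) \<in> borel_measurable lborel"
      "(\<lambda>u. indicat_real {p<..<1} u *\<^sub>R ?Q u) \<in> borel_measurable lborel"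
      unfolding set_integrable_def by (blast intro: borel_measurable_integrable)+
    show "AE u in lborel. indicat_real {p..<1} u *\<^sub>R ?Q u = indicat_real {p<..<1} u *\<^sub>R ?Q u"
      using AE_lborel_singleton[of p] by eventually_elim (auto split: split_indicator)
  qed
  finally show ?thesis
    using p by (simp add: lower_tail_eq_set_integral one_ereal_def interval_integral_Ioo)
qed

end

section \<open>Reduction to lower tails, and Lipschitz bounds in the L1 distance of distribution
  functions\<close>

text \<open>The upper tail beyond \<open>1 - p\<close> is the mean less the lower tail at
  \<open>1 - p\<close>, so only lower tails and the mean have to be estimated.\<close>

lemma GC_cdf_eq:
  assumes "real_distribution N" "integrable N (\<lambda>y. y)" "0 < p" "p < 1"
  shows "GC (cdf N) m p = ((\<integral>y. y \<partial>N) - (lower_tail N (1 - p) + lower_tail N p)) / m"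
  using assms upper_tail_eq[of N "1 - p"] by (simp add: GC_def lower_tail_def)

text \<open>The comparison is through \<open>E(x - X)\<^sup>+ = \<integral>\<^bsub>t<x\<^esub> F(t) dt\<close>.\<close>

lemma max_integral_diff_le:
  assumes "real_distribution N" "integrable N (\<lambda>y. y)" "real_distribution N'" "integrable N' (\<lambda>y. y)"
  shows "ennreal \<bar>(\<integral>y. max 0 (x - y) \<partial>N) - (\<integral>y. max 0 (x - y) \<partial>N')\<bar>
    \<le> (\<integral>\<^sup>+t. ennreal \<bar>cdf N t - cdf N' t\<bar> \<partial>lborel)"
proof -
  note int = integrable_cdf_lessThan[OF assms(1,2), of x] integrable_cdf_lessThan[OF assms(3,4), of x]
  have "ennreal \<bar>(\<integral>y. max 0 (x - y) \<partial>N) - (\<integral>y. max 0 (x - y) \<partial>N')\<bar>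
      = ennreal (norm (\<integral>t. indicator {..<x} t * cdf N t - indicator {..<x} t * cdf N' t \<partial>lborel))"
    using int by (simp add: integral_cdf_lessThan[OF assms(1,2)] integral_cdf_lessThan[OF assms(3,4)])
  also have "\<dots> \<le> (\<integral>\<^sup>+t. norm (indicator {..<x} t * cdf N t - indicator {..<x} t * cdf N' t) \<partial>lborel)"
    using int by (intro integral_norm_bound_ennreal) auto
  also have "\<dots> \<le> (\<integral>\<^sup>+t. ennreal \<bar>cdf N t - cdf N' t\<bar> \<partial>lborel)"
    by (intro nn_integral_mono) (auto split: split_indicator)
  finally show ?thesis .
qed

text \<open>Two maxima differ by at most the largest difference of the maximised functions: the
  maximiser of one distribution is a competitor for the other, and at that point only the two
  positive-part means differ.\<close>

lemma lower_tail_diff_le: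
  assumes "real_distribution N" "integrable N (\<lambda>y. y)" "real_distribution N'" "integrable N' (\<lambda>y. y)"
    and p: "0 < p" "p < 1"
  shows "ennreal \<bar>lower_tail N p - lower_tail N' p\<bar> \<le> (\<integral>\<^sup>+t. ennreal \<bar>cdf N t - cdf N' t\<bar> \<partial>lborel)"
proof -
  have one_sided: "ennreal (lower_tail K p - lower_tail K' p)
      \<le> (\<integral>\<^sup>+t. ennreal \<bar>cdf K t - cdf K' t\<bar> \<partial>lborel)"
    if K: "real_distribution K" "integrable K (\<lambda>y. y)" "real_distribution K'" "integrable K' (\<lambda>y. y)" for K K'
  proof -
    let ?x = "real_of_ereal (quantile (cdf K) p)"
    have "lower_tail K p - lower_tail K' p
        \<le> \<bar>(\<integral>y. max 0 (?x - y) \<partial>K) - (\<integral>y. max 0 (?x - y) \<partial>K')\<bar>"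
      using lower_tail_eq[OF K(1,2) p] lower_tail_ge[OF K(3,4) p, of ?x] by linarith
    then show ?thesis
      using max_integral_diff_le[OF K, of ?x] by (meson ennreal_leI order_trans)
  qed
  show ?thesis
    using one_sided[of N N'] one_sided[of N' N] assms
    by (cases "lower_tail N p \<le> lower_tail N' p")
      (simp_all add: abs_of_nonpos abs_minus_commute[of "cdf N' _"])
qed

text \<open>The mean is the integral of \<open>1 - F\<close> over the right half-line minus that of
  \<open>F\<close> over the left one. In the difference of two means the integrand is, up to sign,
  the difference of the distribution functions.\<close>

lemma expectation_diff_le:
  assumes "real_distribution N" "integrable N (\<lambda>y. y)" "real_distribution N'" "integrable N' (\<lambda>y. y)"
  shows "ennreal \<bar>(\<integral>y. y \<partial>N) - (\<integral>y. y \<partial>N')\<bar> \<le> (\<integral>\<^sup>+t. ennreal \<bar>cdf N t - cdf N' t\<bar> \<partial>lborel)"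
proof -
  let ?h = "\<lambda>K t. indicator {0..} t * (1 - cdf K t) - indicator {..<0} t * cdf K t :: real"
  have eq: "(\<integral>y. y \<partial>K) = (\<integral>t. ?h K t \<partial>lborel) \<and> integrable lborel (?h K)"
    if K: "real_distribution K" "integrable K (\<lambda>y. y)" for K
  proof -
    interpret real_distribution K by fact
    \<comment> \<open>The subtractions involving 0 are kept so that the half-line identities at
      \<open>x = 0\<close> rewrite literally.\<close>
    have "(\<integral>t. ?h K t \<partial>lborel) = (\<integral>y. max 0 (y - 0) \<partial>K) - (\<integral>y. max 0 (0 - y) \<partial>K)"
      by (simp only: Bochner_Integration.integral_diff integrable_cdf_lessThan[OF K] integrable_cdf_atLeast[OF K]
        integral_cdf_lessThan[OF K] integral_cdf_atLeast[OF K])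
    also have "\<dots> = (\<integral>y. max 0 (y - 0) - max 0 (0 - y) \<partial>K)"
      using K(2) by (intro Bochner_Integration.integral_diff[symmetric] integrable_max) auto
    also have "\<dots> = (\<integral>y. y \<partial>K)"
      by (intro Bochner_Integration.integral_cong) auto
    finally show ?thesis
      by (simp only: Bochner_Integration.integrable_diff integrable_cdf_lessThan[OF K] integrable_cdf_atLeast[OF K])
  qed
  note eqs = eq[OF assms(1,2)] eq[OF assms(3,4)]
  have "(\<integral>t. ?h N t - ?h N' t \<partial>lborel) = (\<integral>t. ?h N t \<partial>lborel) - (\<integral>t. ?h N' t \<partial>lborel)"
    by (rule Bochner_Integration.integral_diff[OF eqs(1)[THEN conjunct2] eqs(2)[THEN conjunct2]])
  then have "(\<integral>y. y \<partial>N) - (\<integral>y. y \<partial>N') = (\<integral>t. ?h N t - ?h N' t \<partial>lborel)"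
    using eqs by argo
  then have "ennreal \<bar>(\<integral>y. y \<partial>N) - (\<integral>y. y \<partial>N')\<bar> = ennreal (norm (\<integral>t. ?h N t - ?h N' t \<partial>lborel))"
    by (simp only: real_norm_def)
  also have "\<dots> \<le> (\<integral>\<^sup>+t. norm (?h N t - ?h N' t) \<partial>lborel)"
    by (rule integral_norm_bound_ennreal)
      (rule Bochner_Integration.integrable_diff[OF eqs(1)[THEN conjunct2] eqs(2)[THEN conjunct2]])
  also have "\<dots> \<le> (\<integral>\<^sup>+t. ennreal \<bar>cdf N t - cdf N' t\<bar> \<partial>lborel)"
    by (intro nn_integral_mono ennreal_leI) (auto split: split_indicator)
  finally show ?thesis .
qed

text \<open>If \<open>x\<close> is the \<open>p\<close>-quantile of \<open>N\<close>, the gap between the maximum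
  \<open>lower_tail N p\<close> and the value of the maximised function at another point \<open>q\<close> is
  \<open>\<integral>\<^bsub>[q,x]\<^esub> (p - F(t)) dt\<close>; the excess bounds the integrand wherever \<open>x\<close> may lie.\<close>

definition excess :: "(real \<Rightarrow> real) \<Rightarrow> real \<Rightarrow> real \<Rightarrow> real \<Rightarrow> real" where
  "excess F p q t = max 0 (if q \<le> t then p - F t else F t - p)"

lemma lower_tail_remainder_le:
  assumes N: "real_distribution N" "integrable N (\<lambda>y. y)" and p: "0 < p" "p < 1"
  shows "ennreal (lower_tail N p - (p * q - (\<integral>y. max 0 (q - y) \<partial>N)))
    \<le> (\<integral>\<^sup>+t. ennreal (excess (cdf N) p q t) \<partial>lborel)"
proof -
  define x where "x = real_of_ereal (quantile (cdf N) p)"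
  \<comment> \<open>The signed integrand for either order of \<open>q\<close> and \<open>x\<close>:
    one of the two intervals is always empty. \<open>?g\<close> is its part with the constant
    \<open>p\<close>; what remains is a difference of half-line integrals of
    \<open>cdf N\<close>.\<close>
  let ?f = "\<lambda>t. indicator {q..<x} t * (p - cdf N t) + indicator {x..<q} t * (cdf N t - p)"
  let ?g = "\<lambda>t. p * indicator {q..<x} t - p * indicator {x..<q} t :: real"
  have f: "?f t = ?g t - (indicator {..<x} t * cdf N t - indicator {..<q} t * cdf N t)" for t
    by (auto simp: algebra_simps split: split_indicator)
  note int = integrable_cdf_lessThan[OF N, of x] integrable_cdf_lessThan[OF N, of q]
  have int_g: "integrable lborel ?g"
    by (intro Bochner_Integration.integrable_diff integrable_mult_right integrable_indicator_bounded) auto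
  have int_f: "integrable lborel ?f"
    unfolding f by (intro Bochner_Integration.integrable_diff int int_g)
  have "(\<integral>t. ?g t \<partial>lborel) = p * (x - q)"
    by (cases "q \<le> x") (simp_all add: algebra_simps measure_def)
  moreover have "(\<integral>t. ?f t \<partial>lborel) = (\<integral>t. ?g t \<partial>lborel) - ((\<integral>y. max 0 (x - y) \<partial>N) - (\<integral>y. max 0 (q - y) \<partial>N))"
    unfolding f using int int_g
    by (simp only: Bochner_Integration.integral_diff Bochner_Integration.integrable_diff
      integral_cdf_lessThan[OF N])
  ultimately have "lower_tail N p - (p * q - (\<integral>y. max 0 (q - y) \<partial>N)) = (\<integral>t. ?f t \<partial>lborel)"
    using lower_tail_eq[OF N p] by (simp add: x_def algebra_simps)
  also have "\<dots> \<le> (\<integral>t. max 0 (?f t) \<partial>lborel)"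
    using int_f by (intro integral_mono integrable_max) auto
  finally have "ennreal (lower_tail N p - (p * q - (\<integral>y. max 0 (q - y) \<partial>N))) \<le> ennreal (\<integral>t. max 0 (?f t) \<partial>lborel)"
    by (rule ennreal_leI)
  also have "\<dots> = (\<integral>\<^sup>+t. ennreal (max 0 (?f t)) \<partial>lborel)"
    using int_f by (intro nn_integral_eq_integral[symmetric] integrable_max) auto
  also have "\<dots> \<le> (\<integral>\<^sup>+t. ennreal (excess (cdf N) p q t) \<partial>lborel)"
    by (intro nn_integral_mono ennreal_leI) (auto simp: excess_def split: split_indicator)
  finally show ?thesis .
qed

section \<open>Empirical distributions\<close>

text \<open>As the image of the uniform distribution on the indices it counts ties with
  multiplicity. For \<open>n = 0\<close> the index set is empty and \<open>pmf_of_set\<close>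
  carries no meaning, hence the assumption \<open>0 < n\<close> in what follows.\<close>

definition empirical_distribution :: "(nat \<Rightarrow> 'a \<Rightarrow> real) \<Rightarrow> nat \<Rightarrow> 'a \<Rightarrow> real measure" where
  "empirical_distribution X n \<omega> = distr (measure_pmf (pmf_of_set {1..n})) borel (\<lambda>i. X i \<omega>)"

text \<open>The lower tail of the empirical distribution: the maximum in
  \<open>\<integral>\<^bsub>(0,p)\<^esub> F\<^sub>n\<^sup>-\<^sup>1 = max\<^sub>x (p x - E\<^sub>n(x - X)\<^sup>+)\<close> is attained at a sample point.
  Unlike the left-hand side it is visibly measurable.\<close>

definition sample_lower_tail :: "(nat \<Rightarrow> 'a \<Rightarrow> real) \<Rightarrow> nat \<Rightarrow> real \<Rightarrow> 'a \<Rightarrow> real" where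
  "sample_lower_tail X n p \<omega> =
    Max ((\<lambda>i. p * X i \<omega> - (\<Sum>j=1..n. max 0 (X i \<omega> - X j \<omega>)) / real n) ` {1..n})"

context
  fixes X :: "nat \<Rightarrow> 'a \<Rightarrow> real" and n :: nat and \<omega> :: 'a
  assumes n: "0 < n"
begin

lemma real_distribution_empirical: "real_distribution (empirical_distribution X n \<omega>)"
  unfolding empirical_distribution_def
  by (intro prob_space.real_distribution_distr measure_pmf.prob_space_axioms) simp

lemma integrable_empirical:
  fixes f :: "real \<Rightarrow> real"
  assumes "f \<in> borel_measurable borel"
  shows "integrable (empirical_distribution X n \<omega>) f"
  unfolding empirical_distribution_def using assms n
  by (subst integrable_distr_eq) (auto intro!: integrable_measure_pmf_finite)

lemma integral_empirical:
  fixes f :: "real \<Rightarrow> real"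
  assumes "f \<in> borel_measurable borel"
  shows "(\<integral>y. f y \<partial>empirical_distribution X n \<omega>) = (\<Sum>i=1..n. f (X i \<omega>)) / real n"
  unfolding empirical_distribution_def using assms n
  by (subst integral_distr) (auto simp: integral_pmf_of_set)

lemma expectation_empirical: "(\<integral>y. y \<partial>empirical_distribution X n \<omega>) = sample_mean X n \<omega>"
  by (simp add: integral_empirical sample_mean_def)

lemma cdf_empirical: "cdf (empirical_distribution X n \<omega>) = empirical_cdf X n \<omega>"
proof
  fix x
  have "cdf (empirical_distribution X n \<omega>) x = measure (measure_pmf (pmf_of_set {1..n})) {i. X i \<omega> \<le> x}"
    by (simp add: cdf_def empirical_distribution_def measure_distr vimage_def)
  also have "\<dots> = card ({1..n} \<inter> {i. X i \<omega> \<le> x}) / real n"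
    using n by (subst measure_pmf_of_set) simp_all
  also have "\<dots> = empirical_cdf X n \<omega> x"
    by (simp add: empirical_cdf_def of_bool_def sum.If_cases cong: sum.cong)
  finally show "cdf (empirical_distribution X n \<omega>) x = empirical_cdf X n \<omega> x" .
qed

text \<open>The empirical cdf is constant between neighbouring sample points. A quantile off the
  sample would let the cdf reach level \<open>p\<close> already at a smaller point, against the
  Galois connection.\<close>

lemma quantile_empirical_in_sample:
  assumes p: "0 < p" "p < 1"
  shows "real_of_ereal (quantile (empirical_cdf X n \<omega>) p) \<in> (\<lambda>i. X i \<omega>) ` {1..n}"
proof (rule ccontr)
  define q where "q = real_of_ereal (quantile (empirical_cdf X n \<omega>) p)"
  assume "real_of_ereal (quantile (empirical_cdf X n \<omega>) p) \<notin> (\<lambda>i. X i \<omega>) ` {1..n}"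
  then have notin: "X i \<omega> \<noteq> q" if "i \<in> {1..n}" for i
    using that unfolding q_def by (metis image_eqI)
  have galois: "q \<le> x \<longleftrightarrow> p \<le> empirical_cdf X n \<omega> x" for x
    using quantile_cdf_le_iff[OF real_distribution_empirical p] by (simp add: q_def cdf_empirical)
  \<comment> \<open>The sample points below \<open>q\<close>; the extra element \<open>q - 1\<close>
    makes the set nonempty. No sample point lies strictly between \<open>Max S\<close> and
    \<open>q\<close>.\<close>
  define S where "S = insert (q - 1) {X i \<omega> | i. i \<in> {1..n} \<and> X i \<omega> < q}"
  have fin: "finite S" by (simp add: S_def)
  have ne: "S \<noteq> {}" by (simp add: S_def)
  have "Max S < q" using fin ne by (auto simp: S_def)
  have "X i \<omega> \<le> q \<longleftrightarrow> X i \<omega> \<le> Max S" if "i \<in> {1..n}" for i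
  proof
    assume "X i \<omega> \<le> q"
    then have "X i \<omega> \<in> S" using notin[OF that] that by (auto simp: S_def)
    then show "X i \<omega> \<le> Max S" using fin by simp
  qed (use \<open>Max S < q\<close> in simp)
  then have "empirical_cdf X n \<omega> q = empirical_cdf X n \<omega> (Max S)"
    unfolding empirical_cdf_def by (intro arg_cong2[where f="(*)"] sum.cong refl arg_cong[where f=of_bool]) blast
  then show False
    using galois[of q] galois[of "Max S"] \<open>Max S < q\<close> by simp
qed

text \<open>Every sample point gives a lower bound by \<open>lower_tail_ge\<close>, and the
  quantile, where the bound is attained, is itself a sample point.\<close>

lemma lower_tail_empirical:
  assumes p: "0 < p" "p < 1"
  shows "lower_tail (empirical_distribution X n \<omega>) p = sample_lower_tail X n p \<omega>"
  unfolding sample_lower_tail_def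
proof (rule Max_eqI[symmetric])
  let ?E = "empirical_distribution X n \<omega>"
  have E: "real_distribution ?E" "integrable ?E (\<lambda>y. y)"
    by (auto intro: real_distribution_empirical integrable_empirical)
  have int: "(\<integral>y. max 0 (x - y) \<partial>?E) = (\<Sum>j=1..n. max 0 (x - X j \<omega>)) / real n" for x
    by (rule integral_empirical) simp
  show "y \<le> lower_tail ?E p"
    if "y \<in> (\<lambda>i. p * X i \<omega> - (\<Sum>j=1..n. max 0 (X i \<omega> - X j \<omega>)) / real n) ` {1..n}" for y
    using that lower_tail_ge[OF E p] by (auto simp: int)
  show "lower_tail ?E p \<in> (\<lambda>i. p * X i \<omega> - (\<Sum>j=1..n. max 0 (X i \<omega> - X j \<omega>)) / real n) ` {1..n}"
    using lower_tail_eq[OF E p] quantile_empirical_in_sample[OF p] by (auto simp: int cdf_empirical)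
qed simp

end

lemma empirical_GC_eq:
  assumes "0 < p" "p < 1"
  shows "empirical_GC X n p \<omega> = (sample_mean X n \<omega> -
    (sample_lower_tail X n (1 - p) \<omega> + sample_lower_tail X n p \<omega>)) / sample_mean X n \<omega>"
proof (cases "n = 0")
  \<comment> \<open>The mean of an empty sample is 0, so both sides are quotients by 0 and hence
    0.\<close>
  case True
  then show ?thesis by (simp add: empirical_GC_def GC_def sample_mean_def)
next
  case False
  then have n: "0 < n" by simp
  show ?thesis
    using GC_cdf_eq[OF real_distribution_empirical[OF n] integrable_empirical[OF n] assms, of X \<omega>] assms
    by (simp add: empirical_GC_def cdf_empirical[OF n] expectation_empirical[OF n] lower_tail_empirical[OF n])
qed

lemma borel_measurable_sample_lower_tail [measurable]:
  assumes [measurable]: "\<And>i. X i \<in> borel_measurable M"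
  shows "sample_lower_tail X n p \<in> borel_measurable M"
  unfolding sample_lower_tail_def by measurable

lemma borel_measurable_sample_mean [measurable]:
  assumes [measurable]: "\<And>i. X i \<in> borel_measurable M"
  shows "sample_mean X n \<in> borel_measurable M"
  unfolding sample_mean_def by measurable

text \<open>Both modes of convergence demand measurability for every \<open>n\<close>; it is read
  off the closed formula, which covers \<open>n = 0\<close> as well.\<close>

lemma borel_measurable_empirical_GC:
  assumes [measurable]: "\<And>i. X i \<in> borel_measurable M" and p: "0 < p" "p < 1"
  shows "empirical_GC X n p \<in> borel_measurable M"
proof -
  have "empirical_GC X n p = (\<lambda>\<omega>. (sample_mean X n \<omega> -
    (sample_lower_tail X n (1 - p) \<omega> + sample_lower_tail X n p \<omega>)) / sample_mean X n \<omega>)"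
    by (intro ext empirical_GC_eq p)
  also have "\<dots> \<in> borel_measurable M" by measurable
  finally show ?thesis .
qed

section \<open>Convergence in probability and in distribution\<close>

lemma tendsto_in_probabilityD:
  assumes "tendsto_in_probability M Z W" "0 < \<epsilon>"
  shows "(\<lambda>n. measure M {\<omega> \<in> space M. \<epsilon> < \<bar>Z n \<omega> - W \<omega>\<bar>}) \<longlonglongrightarrow> 0"
  using assms by (simp add: tendsto_in_probability_def)

context prob_space
begin

text \<open>Markov's inequality. The bound is asked for only when \<open>0 < n\<close>, where the
  empirical distribution makes sense, and may be infinite for some \<open>n\<close>.\<close>

lemma tendsto_in_probabilityI_nn_integral:
  assumes [measurable]: "\<And>n. Z n \<in> borel_measurable M" "W \<in> borel_measurable M"
    and bound: "\<And>n. 0 < n \<Longrightarrow> (\<integral>\<^sup>+\<omega>. ennreal \<bar>Z n \<omega> - W \<omega>\<bar> \<partial>M) \<le> b n"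
    and b: "b \<longlonglongrightarrow> 0"
  shows "tendsto_in_probability M Z W"
  unfolding tendsto_in_probability_def
proof (intro conjI allI impI)
  fix \<epsilon> :: real assume "0 < \<epsilon>"
  have le: "prob {\<omega> \<in> space M. \<epsilon> < \<bar>Z n \<omega> - W \<omega>\<bar>} \<le> ennreal (1 / \<epsilon>) * b n" if "0 < n" for n
  proof -
    have "1 \<le> ennreal (1 / \<epsilon>) * ennreal a" if "\<epsilon> < a" for a
      using that \<open>0 < \<epsilon>\<close> by (simp add: ennreal_mult[symmetric] ennreal_1[symmetric] del: ennreal_1)
    then have "emeasure M {\<omega> \<in> space M. \<epsilon> < \<bar>Z n \<omega> - W \<omega>\<bar>}
        \<le> emeasure M {\<omega> \<in> space M. 1 \<le> ennreal (1 / \<epsilon>) * ennreal \<bar>Z n \<omega> - W \<omega>\<bar>}"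
      by (intro emeasure_mono) auto
    also have "\<dots> \<le> ennreal (1 / \<epsilon>) * (\<integral>\<^sup>+\<omega>. ennreal \<bar>Z n \<omega> - W \<omega>\<bar> * indicator (space M) \<omega> \<partial>M)"
      by (intro nn_integral_Markov_inequality) auto
    also have "\<dots> = ennreal (1 / \<epsilon>) * (\<integral>\<^sup>+\<omega>. ennreal \<bar>Z n \<omega> - W \<omega>\<bar> \<partial>M)"
      by (intro arg_cong[where f="(*) _"] nn_integral_cong) simp
    also have "\<dots> \<le> ennreal (1 / \<epsilon>) * b n"
      by (intro mult_left_mono bound that) simp
    finally show ?thesis by (simp add: emeasure_eq_measure)
  qed
  have lim: "(\<lambda>n. ennreal (1 / \<epsilon>) * b n) \<longlonglongrightarrow> 0"
    using ennreal_tendsto_cmult[OF _ b, of "ennreal (1 / \<epsilon>)"] by simp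
  have "\<forall>\<^sub>F n in sequentially. ennreal (prob {\<omega> \<in> space M. \<epsilon> < \<bar>Z n \<omega> - W \<omega>\<bar>}) \<le> ennreal (1 / \<epsilon>) * b n"
    by (intro eventually_sequentiallyI[of 1] le) simp
  from tendsto_sandwich[OF _ this tendsto_const lim]
  have "(\<lambda>n. ennreal (prob {\<omega> \<in> space M. \<epsilon> < \<bar>Z n \<omega> - W \<omega>\<bar>})) \<longlonglongrightarrow> 0"
    by simp
  then show "(\<lambda>n. prob {\<omega> \<in> space M. \<epsilon> < \<bar>Z n \<omega> - W \<omega>\<bar>}) \<longlonglongrightarrow> 0"
    by (subst (asm) ennreal_tendsto_0_iff) auto
qed auto

text \<open>Continuous mapping with constant limits. Continuity at the single point
  \<open>(a, b)\<close> is what allows division by a sample mean with nonzero limit.\<close>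

lemma tendsto_in_probability_isCont2:
  fixes f :: "real \<times> real \<Rightarrow> real"
  assumes A: "tendsto_in_probability M A (\<lambda>_. a)" and B: "tendsto_in_probability M B (\<lambda>_. b)"
    and f: "isCont f (a, b)" and meas: "\<And>n. (\<lambda>\<omega>. f (A n \<omega>, B n \<omega>)) \<in> borel_measurable M"
  shows "tendsto_in_probability M (\<lambda>n \<omega>. f (A n \<omega>, B n \<omega>)) (\<lambda>_. f (a, b))"
  unfolding tendsto_in_probability_def
proof (intro conjI allI impI meas)
  fix \<epsilon> :: real assume "0 < \<epsilon>"
  note [measurable] = meas
  have [measurable]: "\<And>n. A n \<in> borel_measurable M" "\<And>n. B n \<in> borel_measurable M"
    using A B by (auto simp: tendsto_in_probability_def)
  from f \<open>0 < \<epsilon>\<close> obtain d where d: "0 < d" "\<And>z. dist z (a, b) < d \<Longrightarrow> dist (f z) (f (a, b)) < \<epsilon>"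
    unfolding continuous_at_eps_delta by blast
  \<comment> \<open>With \<open>d / 3\<close> in each coordinate the distance is at most
    \<open>2 * d / 3\<close>, strictly below \<open>d\<close>.\<close>
  have near: "\<bar>f (x, y) - f (a, b)\<bar> < \<epsilon>" if "\<bar>x - a\<bar> \<le> d / 3" "\<bar>y - b\<bar> \<le> d / 3" for x y
  proof -
    have "dist (x, y) (a, b) \<le> \<bar>x - a\<bar> + \<bar>y - b\<bar>"
      by (simp add: dist_Pair_Pair dist_real_def sqrt_sum_squares_le_sum_abs)
    then show ?thesis using d(2)[of "(x, y)"] that \<open>0 < d\<close> by (simp add: dist_real_def)
  qed
  have lim: "(\<lambda>n. prob {\<omega> \<in> space M. d / 3 < \<bar>A n \<omega> - a\<bar>} + prob {\<omega> \<in> space M. d / 3 < \<bar>B n \<omega> - b\<bar>}) \<longlonglongrightarrow> 0"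
    using \<open>0 < d\<close> by (intro tendsto_add_zero tendsto_in_probabilityD[OF A] tendsto_in_probabilityD[OF B]) auto
  have le: "prob {\<omega> \<in> space M. \<epsilon> < \<bar>f (A n \<omega>, B n \<omega>) - f (a, b)\<bar>}
      \<le> prob {\<omega> \<in> space M. d / 3 < \<bar>A n \<omega> - a\<bar>} + prob {\<omega> \<in> space M. d / 3 < \<bar>B n \<omega> - b\<bar>}" for n
  proof -
    have "prob {\<omega> \<in> space M. \<epsilon> < \<bar>f (A n \<omega>, B n \<omega>) - f (a, b)\<bar>}
        \<le> prob ({\<omega> \<in> space M. d / 3 < \<bar>A n \<omega> - a\<bar>} \<union> {\<omega> \<in> space M. d / 3 < \<bar>B n \<omega> - b\<bar>})"
      by (rule finite_measure_mono) (use near in \<open>force simp: not_less[symmetric]\<close>, measurable)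
    also have "\<dots> \<le> prob {\<omega> \<in> space M. d / 3 < \<bar>A n \<omega> - a\<bar>} + prob {\<omega> \<in> space M. d / 3 < \<bar>B n \<omega> - b\<bar>}"
      by (intro measure_Un_le) measurable
    finally show ?thesis .
  qed
  show "(\<lambda>n. prob {\<omega> \<in> space M. \<epsilon> < \<bar>f (A n \<omega>, B n \<omega>) - f (a, b)\<bar>}) \<longlonglongrightarrow> 0"
    by (rule tendsto_sandwich[OF _ _ tendsto_const lim]; intro always_eventually allI measure_nonneg le)
qed simp

text \<open>The sequences can differ only where \<open>A n\<close> is far from \<open>a\<close>, an
  event of vanishing probability. This disposes of samples whose mean is 0.\<close>

lemma tendsto_in_probability_cong_on_likely:
  assumes Z: "tendsto_in_probability M Z (\<lambda>_. c)" and A: "tendsto_in_probability M A (\<lambda>_. a)"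
    and "0 < d" and meas: "\<And>n. Z' n \<in> borel_measurable M"
    and eq: "\<And>n \<omega>. 0 < n \<Longrightarrow> \<bar>A n \<omega> - a\<bar> \<le> d \<Longrightarrow> Z' n \<omega> = Z n \<omega>"
  shows "tendsto_in_probability M Z' (\<lambda>_. c)"
  unfolding tendsto_in_probability_def
proof (intro conjI allI impI meas)
  fix \<epsilon> :: real assume "0 < \<epsilon>"
  note [measurable] = meas
  have [measurable]: "\<And>n. A n \<in> borel_measurable M" "\<And>n. Z n \<in> borel_measurable M"
    using A Z by (auto simp: tendsto_in_probability_def)
  have lim: "(\<lambda>n. prob {\<omega> \<in> space M. \<epsilon> < \<bar>Z n \<omega> - c\<bar>} + prob {\<omega> \<in> space M. d < \<bar>A n \<omega> - a\<bar>}) \<longlonglongrightarrow> 0"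
    using \<open>0 < d\<close> \<open>0 < \<epsilon>\<close>
    by (intro tendsto_add_zero tendsto_in_probabilityD[OF A] tendsto_in_probabilityD[OF Z]) auto
  have le: "prob {\<omega> \<in> space M. \<epsilon> < \<bar>Z' n \<omega> - c\<bar>}
      \<le> prob {\<omega> \<in> space M. \<epsilon> < \<bar>Z n \<omega> - c\<bar>} + prob {\<omega> \<in> space M. d < \<bar>A n \<omega> - a\<bar>}" if "0 < n" for n
  proof -
    have "prob {\<omega> \<in> space M. \<epsilon> < \<bar>Z' n \<omega> - c\<bar>}
        \<le> prob ({\<omega> \<in> space M. \<epsilon> < \<bar>Z n \<omega> - c\<bar>} \<union> {\<omega> \<in> space M. d < \<bar>A n \<omega> - a\<bar>})"
      by (rule finite_measure_mono) (use eq[OF that] in \<open>force simp: not_less[symmetric]\<close>, measurable)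
    also have "\<dots> \<le> prob {\<omega> \<in> space M. \<epsilon> < \<bar>Z n \<omega> - c\<bar>} + prob {\<omega> \<in> space M. d < \<bar>A n \<omega> - a\<bar>}"
      by (intro measure_Un_le) measurable
    finally show ?thesis .
  qed
  show "(\<lambda>n. prob {\<omega> \<in> space M. \<epsilon> < \<bar>Z' n \<omega> - c\<bar>}) \<longlonglongrightarrow> 0"
    by (rule tendsto_sandwich[OF _ _ tendsto_const lim])
      (intro always_eventually allI measure_nonneg, intro eventually_sequentiallyI[of 1] le, simp)
qed simp

text \<open>A null sequence times a tight one is null; tightness comes from Markov's inequality for
  the squares. If the product exceeds \<open>\<epsilon>\<close>, then \<open>T n\<close> exceeds
  \<open>K\<close> or \<open>U n\<close> exceeds \<open>\<epsilon> / K\<close>.\<close>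

lemma tendsto_in_probability_mult_L2_bounded:
  assumes U: "tendsto_in_probability M U (\<lambda>_. 0)"
    and T: "\<And>n. T n \<in> borel_measurable M" "\<And>n. integrable M (\<lambda>\<omega>. (T n \<omega>)\<^sup>2)"
    and C: "\<And>n. expectation (\<lambda>\<omega>. (T n \<omega>)\<^sup>2) \<le> C"
  shows "tendsto_in_probability M (\<lambda>n \<omega>. U n \<omega> * T n \<omega>) (\<lambda>_. 0)"
  unfolding tendsto_in_probability_def
proof (intro conjI allI impI)
  note [measurable] = T(1)
  have [measurable]: "\<And>n. U n \<in> borel_measurable M"
    using U by (auto simp: tendsto_in_probability_def)
  show "(\<lambda>\<omega>. U n \<omega> * T n \<omega>) \<in> borel_measurable M" for n by measurable
  fix \<epsilon> :: real assume \<epsilon>: "0 < \<epsilon>"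
  have tail: "prob {\<omega> \<in> space M. K < \<bar>T n \<omega>\<bar>} \<le> C / K\<^sup>2" if "0 < K" for K n
  proof -
    have "prob {\<omega> \<in> space M. K < \<bar>T n \<omega>\<bar>} \<le> prob {\<omega> \<in> space M. K\<^sup>2 \<le> (T n \<omega>)\<^sup>2}"
      using that by (intro finite_measure_mono) (auto simp: abs_le_square_iff[symmetric])
    also have "\<dots> \<le> expectation (\<lambda>\<omega>. (T n \<omega>)\<^sup>2) / K\<^sup>2"
      using that by (intro integral_Markov_inequality_measure[OF T(2), where A="{}"]) auto
    also have "\<dots> \<le> C / K\<^sup>2" by (intro divide_right_mono C) simp
    finally show ?thesis .
  qed
  show "(\<lambda>n. prob {\<omega> \<in> space M. \<epsilon> < \<bar>U n \<omega> * T n \<omega> - 0\<bar>}) \<longlonglongrightarrow> 0"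
  proof (rule LIMSEQ_I)
    fix r :: real assume r: "0 < r"
    have "0 \<le> C" using order_trans[OF _ C[of 0]] by simp
    \<comment> \<open>Chosen so that the tail bound \<open>C / K\<close> with squared
      \<open>K\<close> is below \<open>r / 2\<close>; the summand 1 keeps \<open>K\<close> positive
      when \<open>C = 0\<close>.\<close>
    define K where "K = sqrt (2 * (C + 1) / r)"
    have K: "0 < K" "C / K\<^sup>2 < r / 2"
      using r \<open>0 \<le> C\<close> by (auto simp: K_def field_simps)
    have "(\<lambda>n. prob {\<omega> \<in> space M. \<epsilon> / K < \<bar>U n \<omega> - 0\<bar>}) \<longlonglongrightarrow> 0"
      using K(1) \<epsilon> by (intro tendsto_in_probabilityD[OF U]) simp
    from LIMSEQ_D[OF this, of "r / 2"] r
    obtain n0 where n0: "\<And>n. n0 \<le> n \<Longrightarrow> prob {\<omega> \<in> space M. \<epsilon> / K < \<bar>U n \<omega>\<bar>} < r / 2"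
      by (simp del: less_divide_eq_numeral1) blast
    have "prob {\<omega> \<in> space M. \<epsilon> < \<bar>U n \<omega> * T n \<omega>\<bar>} < r" if "n0 \<le> n" for n
    proof -
      have "\<bar>U n \<omega> * T n \<omega>\<bar> \<le> \<epsilon>" if "\<bar>U n \<omega>\<bar> \<le> \<epsilon> / K" "\<bar>T n \<omega>\<bar> \<le> K" for \<omega>
        using mult_mono[OF that] K(1) \<epsilon> by (simp add: abs_mult)
      then have "prob {\<omega> \<in> space M. \<epsilon> < \<bar>U n \<omega> * T n \<omega>\<bar>}
        \<le> prob ({\<omega> \<in> space M. \<epsilon> / K < \<bar>U n \<omega>\<bar>} \<union> {\<omega> \<in> space M. K < \<bar>T n \<omega>\<bar>})"
        by (intro finite_measure_mono) (force simp: not_less[symmetric], measurable)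
      also have "\<dots> \<le> prob {\<omega> \<in> space M. \<epsilon> / K < \<bar>U n \<omega>\<bar>} + prob {\<omega> \<in> space M. K < \<bar>T n \<omega>\<bar>}"
        by (intro measure_Un_le) measurable
      also have "\<dots> < r" using n0[OF that] tail[OF K(1), of n] K(2) by linarith
      finally show ?thesis .
    qed
    then show "\<exists>n0. \<forall>n\<ge>n0. norm (prob {\<omega> \<in> space M. \<epsilon> < \<bar>U n \<omega> * T n \<omega> - 0\<bar>} - 0) < r"
      by (intro exI[of _ n0]) simp
  qed
qed simp

section \<open>Second moments of sums of independent variables\<close>

text \<open>Induction on \<open>I\<close>: the new summand is independent of the partial sum, so the
  cross term is integrable and its mean is a product of means, hence 0.\<close>

lemma
  fixes Z :: "'i \<Rightarrow> 'a \<Rightarrow> real"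
  assumes "finite I" "indep_vars (\<lambda>_. borel) Z I"
    and "\<And>i. i \<in> I \<Longrightarrow> integrable M (\<lambda>\<omega>. (Z i \<omega>)\<^sup>2)" "\<And>i. i \<in> I \<Longrightarrow> expectation (Z i) = 0"
  shows integrable_sum_indep_square: "integrable M (\<lambda>\<omega>. (\<Sum>i\<in>I. Z i \<omega>)\<^sup>2)"
    and expectation_sum_indep_square:
      "expectation (\<lambda>\<omega>. (\<Sum>i\<in>I. Z i \<omega>)\<^sup>2) = (\<Sum>i\<in>I. expectation (\<lambda>\<omega>. (Z i \<omega>)\<^sup>2))"
proof -
  have "integrable M (\<lambda>\<omega>. (\<Sum>i\<in>I. Z i \<omega>)\<^sup>2) \<and>
    expectation (\<lambda>\<omega>. (\<Sum>i\<in>I. Z i \<omega>)\<^sup>2) = (\<Sum>i\<in>I. expectation (\<lambda>\<omega>. (Z i \<omega>)\<^sup>2))"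
    using assms
  proof (induction I rule: finite_induct)
    case empty
    then show ?case by simp
  next
    case (insert i I)
    let ?S = "\<lambda>\<omega>. \<Sum>j\<in>I. Z j \<omega>"
    have "indep_vars (\<lambda>_. borel) Z I"
      using insert.prems(1) by (rule indep_vars_subset) auto
    then have IH: "integrable M (\<lambda>\<omega>. (?S \<omega>)\<^sup>2)"
        "expectation (\<lambda>\<omega>. (?S \<omega>)\<^sup>2) = (\<Sum>i\<in>I. expectation (\<lambda>\<omega>. (Z i \<omega>)\<^sup>2))"
      using insert.IH insert.prems by auto
    have meas: "Z j \<in> borel_measurable M" if "j \<in> insert i I" for j
      using insert.prems(1) that unfolding indep_vars_def2 by blast
    have intZ: "integrable M (Z j)" if "j \<in> insert i I" for j
      by (rule square_integrable_imp_integrable[OF meas[OF that] insert.prems(2)[OF that]])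
    have intS: "integrable M ?S"
      by (intro Bochner_Integration.integrable_sum intZ) simp
    have ind: "indep_var borel (Z i) borel ?S"
      by (rule indep_vars_sum[OF insert.hyps insert.prems(1)])
    have cross: "integrable M (\<lambda>\<omega>. Z i \<omega> * ?S \<omega>)" "expectation (\<lambda>\<omega>. Z i \<omega> * ?S \<omega>) = 0"
      using indep_var_integrable[OF ind intZ intS] indep_var_lebesgue_integral[OF ind intZ intS] insert.prems(3)[of i]
      by simp_all
    have sq: "(\<Sum>j\<in>insert i I. Z j \<omega>)\<^sup>2 = (Z i \<omega>)\<^sup>2 + 2 * (Z i \<omega> * ?S \<omega>) + (?S \<omega>)\<^sup>2" for \<omega>
      using insert.hyps by (simp add: power2_sum)
    have Zi: "integrable M (\<lambda>\<omega>. (Z i \<omega>)\<^sup>2)" using insert.prems(2) by simp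
    show ?case
      unfolding sq using Zi cross IH insert.hyps by simp
  qed
  then show "integrable M (\<lambda>\<omega>. (\<Sum>i\<in>I. Z i \<omega>)\<^sup>2)"
    "expectation (\<lambda>\<omega>. (\<Sum>i\<in>I. Z i \<omega>)\<^sup>2) = (\<Sum>i\<in>I. expectation (\<lambda>\<omega>. (Z i \<omega>)\<^sup>2))"
    by auto
qed

end

section \<open>Normal limits: the central limit theorem and Slutsky's theorem\<close>

lemma normal_distribution_eq_distr:
  assumes "0 < v"
  shows "normal_distribution 0 v = distr std_normal_distribution borel (\<lambda>x. sqrt v * x)"
proof -
  interpret real_distribution std_normal_distribution by (rule real_dist_normal_dist)
  have "distributed std_normal_distribution lborel (\<lambda>x. x) std_normal_density"
    by (simp add: distributed_def distr_id2)
  from normal_density_affine[OF this, of "sqrt v" 0] assms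
  have "distributed std_normal_distribution lborel (\<lambda>x. sqrt v * x) (normal_density 0 (sqrt v))"
    by simp
  then have "distr std_normal_distribution lborel (\<lambda>x. sqrt v * x) = density lborel (normal_density 0 (sqrt v))"
    by (simp add: distributed_def)
  moreover have "distr std_normal_distribution lborel (\<lambda>x. sqrt v * x) = distr std_normal_distribution borel (\<lambda>x. sqrt v * x)"
    by (rule distr_cong) simp_all
  ultimately show ?thesis using assms by (simp add: normal_distribution_def)
qed

lemma real_distribution_normal_distribution:
  assumes "0 \<le> v"
  shows "real_distribution (normal_distribution 0 v)"
proof (cases "v = 0")
  case True
  interpret prob_space "return borel (0::real)" by (rule prob_space_return) simp
  show ?thesis using True by (auto simp: normal_distribution_def real_distribution_def real_distribution_axioms_def prob_space_axioms)
next
  case False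
  interpret real_distribution std_normal_distribution by (rule real_dist_normal_dist)
  show ?thesis using False assms by (subst normal_distribution_eq_distr) (auto intro!: real_distribution_distr)
qed

context prob_space
begin

lemma char_distr_scale:
  assumes [measurable]: "Z \<in> borel_measurable M"
  shows "char (distr M borel (\<lambda>\<omega>. c * Z \<omega>)) t = char (distr M borel Z) (t * c)"
  by (simp add: char_def integral_distr mult.assoc)

text \<open>If \<open>v = 0\<close>, every \<open>Z i\<close> vanishes almost surely and all normed
  sums have the point mass at 0 as law. Otherwise the library's theorem, which normalises by the
  standard deviation, is rescaled: scaling by \<open>sqrt v\<close> moves the argument of the
  characteristic functions to \<open>t * sqrt v\<close>, and Levy continuity converts back.\<close>

lemma central_limit_theorem_normal_distribution:
  fixes Z :: "nat \<Rightarrow> 'a \<Rightarrow> real"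
  assumes indep: "indep_vars (\<lambda>_. borel) Z UNIV"
    and mean: "\<And>i. expectation (Z i) = 0" and sq: "\<And>i. integrable M (\<lambda>\<omega>. (Z i \<omega>)\<^sup>2)"
    and var: "\<And>i. expectation (\<lambda>\<omega>. (Z i \<omega>)\<^sup>2) = v" and ident: "\<And>i. distr M borel (Z i) = D"
  shows "weak_conv_m (\<lambda>n. distr M borel (\<lambda>\<omega>. (\<Sum>i<n. Z i \<omega>) / sqrt (real n))) (normal_distribution 0 v)"
proof (cases "v = 0")
  case True
  have [measurable]: "Z i \<in> borel_measurable M" for i
    using indep by (simp add: indep_vars_def2)
  have "AE \<omega> in M. Z i \<omega> = 0" for i
    using integral_nonneg_eq_0_iff_AE[OF sq, of i] var[of i] True by simp
  then have "AE \<omega> in M. \<forall>i. Z i \<omega> = 0"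
    by (simp add: AE_all_countable)
  then have "AE \<omega> in M. (\<Sum>i<n. Z i \<omega>) / sqrt (real n) = 0" for n
    by eventually_elim simp
  then have "distr M borel (\<lambda>\<omega>. (\<Sum>i<n. Z i \<omega>) / sqrt (real n)) = distr M borel (\<lambda>_. 0)" for n
    by (intro distr_cong_AE) auto
  moreover have "distr M borel (\<lambda>_. 0::real) = return borel 0"
    by (rule measure_eqI) (auto simp: emeasure_distr emeasure_space_1 split: split_indicator)
  ultimately show ?thesis
    using True by (simp add: normal_distribution_def weak_conv_m_def weak_conv_def)
next
  case False
  have [measurable]: "Z i \<in> borel_measurable M" for i
    using indep by (simp add: indep_vars_def2)
  have "0 \<le> expectation (\<lambda>\<omega>. (Z 0 \<omega>)\<^sup>2)" by simp
  then have "0 \<le> v" by (simp add: var)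
  then have v: "0 < v" using False by simp
  let ?W = "\<lambda>n \<omega>. (\<Sum>i<n. Z i \<omega>) / sqrt (real n * (sqrt v)\<^sup>2)"
  have clt: "weak_conv_m (\<lambda>n. distr M borel (?W n)) std_normal_distribution"
    using v by (intro central_limit_theorem_zero_mean[OF indep mean _ sq _ ident]) (auto simp: mean var)
  have W: "(\<lambda>\<omega>. (\<Sum>i<n. Z i \<omega>) / sqrt (real n)) = (\<lambda>\<omega>. sqrt v * ?W n \<omega>)" for n
    using v by (auto simp: real_sqrt_mult)
  interpret S: real_distribution std_normal_distribution by (rule real_dist_normal_dist)
  show ?thesis
  proof (rule levy_continuity)
    show "real_distribution (distr M borel (\<lambda>\<omega>. (\<Sum>i<n. Z i \<omega>) / sqrt (real n)))" for n
      by (intro real_distribution_distr) measurable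
    show "real_distribution (normal_distribution 0 v)"
      using v by (intro real_distribution_normal_distribution) simp
    show "(\<lambda>n. char (distr M borel (\<lambda>\<omega>. (\<Sum>i<n. Z i \<omega>) / sqrt (real n))) t) \<longlonglongrightarrow> char (normal_distribution 0 v) t" for t
    proof -
      have "char (distr M borel (\<lambda>\<omega>. (\<Sum>i<n. Z i \<omega>) / sqrt (real n))) t = char (distr M borel (?W n)) (t * sqrt v)" for n
        unfolding W by (rule char_distr_scale) measurable
      moreover have "char (normal_distribution 0 v) t = char std_normal_distribution (t * sqrt v)"
        unfolding normal_distribution_eq_distr[OF v]
        using S.char_distr_scale[of "\<lambda>x. x" "sqrt v" t] by (simp add: distr_id2)
      moreover have "(\<lambda>n. char (distr M borel (?W n)) (t * sqrt v)) \<longlonglongrightarrow> char std_normal_distribution (t * sqrt v)"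
        by (rule levy_continuity1[OF _ _ clt]) (auto intro!: real_distribution_distr real_dist_normal_dist)
      ultimately show ?thesis by simp
    qed
  qed
qed

text \<open>Slutsky's theorem, by comparing characteristic functions.\<close>

lemma weak_conv_m_distr_perturb:
  assumes conv: "weak_conv_m (\<lambda>n. distr M borel (T n)) N" and N: "real_distribution N"
    and meas[measurable]: "\<And>n. T n \<in> borel_measurable M" "\<And>n. Z n \<in> borel_measurable M"
    and diff: "tendsto_in_probability M (\<lambda>n \<omega>. Z n \<omega> - T n \<omega>) (\<lambda>_. 0)"
  shows "weak_conv_m (\<lambda>n. distr M borel (Z n)) N"
proof (rule levy_continuity)
  show "real_distribution (distr M borel (Z n))" for n
    by (intro real_distribution_distr) measurable
  show "real_distribution N" by fact
  show "(\<lambda>n. char (distr M borel (Z n)) t) \<longlonglongrightarrow> char N t" for t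
  proof -
    have T: "(\<lambda>n. char (distr M borel (T n)) t) \<longlonglongrightarrow> char N t"
      by (rule levy_continuity1[OF _ N conv]) (intro real_distribution_distr, measurable)
    \<comment> \<open>Factoring out a number of modulus 1 leaves
      \<open>iexp (t * (a - b)) - 1\<close>, which gives the Lipschitz bound; the bound 2 is the
      triangle inequality.\<close>
    have dist: "cmod (iexp (t * a) - iexp (t * b)) \<le> min 2 (\<bar>t\<bar> * \<bar>a - b\<bar>)" for a b
    proof -
      have "iexp (t * a) - iexp (t * b) = iexp (t * b) * (iexp (t * (a - b)) - 1)"
        by (simp add: algebra_simps exp_add[symmetric])
      then have "cmod (iexp (t * a) - iexp (t * b)) = cmod (iexp (t * (a - b)) - 1)"
        by (simp add: norm_mult)
      also have "\<dots> \<le> \<bar>t * (a - b)\<bar>"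
        using iexp_approx1[of "t * (a - b)" 0] by simp
      finally have "cmod (iexp (t * a) - iexp (t * b)) \<le> \<bar>t\<bar> * \<bar>a - b\<bar>"
        by (simp add: abs_mult)
      moreover have "cmod (iexp (t * a) - iexp (t * b)) \<le> 2"
        by (rule order_trans[OF norm_triangle_ineq4]) simp
      ultimately show ?thesis by simp
    qed
    \<comment> \<open>The Lipschitz bound is used where the perturbation is at most
      \<open>\<delta>\<close>, the bound 2 on the remaining event.\<close>
    have bound: "cmod (char (distr M borel (Z n)) t - char (distr M borel (T n)) t)
        \<le> \<bar>t\<bar> * \<delta> + 2 * prob {\<omega> \<in> space M. \<delta> < \<bar>Z n \<omega> - T n \<omega> - 0\<bar>}" if "0 < \<delta>" for n \<delta>
    proof -
      let ?A = "{\<omega> \<in> space M. \<delta> < \<bar>Z n \<omega> - T n \<omega> - 0\<bar>}"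
      have int: "integrable M (\<lambda>\<omega>. iexp (t * Y \<omega>))" if [measurable]: "Y \<in> borel_measurable M" for Y
        by (rule integrable_iexp) auto
      have A: "?A \<in> sets M" by measurable
      have "char (distr M borel (Z n)) t - char (distr M borel (T n)) t
          = (\<integral>\<omega>. iexp (t * Z n \<omega>) - iexp (t * T n \<omega>) \<partial>M)"
        by (simp add: char_def integral_distr Bochner_Integration.integral_diff[OF int int] del: of_real_mult)
      also have "cmod \<dots> \<le> (\<integral>\<omega>. cmod (iexp (t * Z n \<omega>) - iexp (t * T n \<omega>)) \<partial>M)"
        by (rule integral_norm_bound)
      also have "\<dots> \<le> (\<integral>\<omega>. \<bar>t\<bar> * \<delta> + 2 * indicator ?A \<omega> \<partial>M)"
      proof (rule integral_mono)
        show "integrable M (\<lambda>\<omega>. cmod (iexp (t * Z n \<omega>) - iexp (t * T n \<omega>)))"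
          by (intro integrable_norm Bochner_Integration.integrable_diff int) measurable
        show "integrable M (\<lambda>\<omega>. \<bar>t\<bar> * \<delta> + 2 * indicator ?A \<omega>)"
          using A by (intro Bochner_Integration.integrable_add integrable_mult_right integrable_real_indicator)
            (auto simp: emeasure_eq_measure)
        fix \<omega> assume "\<omega> \<in> space M"
        show "cmod (iexp (t * Z n \<omega>) - iexp (t * T n \<omega>)) \<le> \<bar>t\<bar> * \<delta> + 2 * indicator ?A \<omega>"
        proof (cases "\<delta> < \<bar>Z n \<omega> - T n \<omega>\<bar>")
          case True
          have "0 \<le> \<bar>t\<bar> * \<delta>" using that by simp
          with True show ?thesis using dist[of "Z n \<omega>" "T n \<omega>"] \<open>\<omega> \<in> space M\<close> by simp
        next
          case False
          then have "\<bar>t\<bar> * \<bar>Z n \<omega> - T n \<omega>\<bar> \<le> \<bar>t\<bar> * \<delta>" by (intro mult_left_mono) auto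
          with False show ?thesis using dist[of "Z n \<omega>" "T n \<omega>"] by simp
        qed
      qed
      also have "\<dots> = \<bar>t\<bar> * \<delta> + 2 * prob ?A"
        using A by (subst Bochner_Integration.integral_add) (auto simp: emeasure_eq_measure prob_space)
      finally show ?thesis .
    qed
    have "(\<lambda>n. char (distr M borel (Z n)) t - char (distr M borel (T n)) t) \<longlonglongrightarrow> 0"
    proof (rule LIMSEQ_I)
      fix r :: real assume r: "0 < r"
      \<comment> \<open>This makes the Lipschitz part less than \<open>r / 2\<close>, also for
        \<open>t = 0\<close>; the other part is twice a probability below
        \<open>r / 4\<close>.\<close>
      define \<delta> where "\<delta> = r / (2 * (\<bar>t\<bar> + 1))"
      have \<delta>: "0 < \<delta>" using r by (simp add: \<delta>_def)
      have "\<bar>t\<bar> * \<delta> < r / 2" using r by (simp add: \<delta>_def field_simps)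
      from tendsto_in_probabilityD[OF diff \<delta>, THEN LIMSEQ_D, of "r / 4"] r
      obtain n0 where n0: "\<And>n. n0 \<le> n \<Longrightarrow> prob {\<omega> \<in> space M. \<delta> < \<bar>Z n \<omega> - T n \<omega> - 0\<bar>} < r / 4"
        by (simp del: less_divide_eq_numeral1 diff_0_right) (auto simp del: less_divide_eq_numeral1 diff_0_right)
      have "cmod (char (distr M borel (Z n)) t - char (distr M borel (T n)) t) < r" if "n0 \<le> n" for n
        using bound[OF \<delta>, of n] n0[OF that] \<open>\<bar>t\<bar> * \<delta> < r / 2\<close> by linarith
      then show "\<exists>n0. \<forall>n\<ge>n0. norm (char (distr M borel (Z n)) t - char (distr M borel (T n)) t - 0) < r"
        by (intro exI[of _ n0]) simp
    qed
    from tendsto_add[OF this T] show ?thesis by simp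
  qed
qed

end

section \<open>Independent samples\<close>

lemma sqrt_mult_divide:
  fixes n :: nat
  assumes "0 < n"
  shows "sqrt (real n) * (x / real n) = x / sqrt (real n)"
proof -
  define c where "c = sqrt (real n)"
  have "0 < c" "real n = c * c" using assms by (simp_all add: c_def)
  then show ?thesis by (simp add: c_def[symmetric])
qed

text \<open>\<open>X 0\<close> plays the generic variable \<open>X\<close>; samples consist of
  \<open>X 1, ..., X n\<close>.\<close>

locale iid_sample = prob_space M for M :: "'a measure" +
  fixes X :: "nat \<Rightarrow> 'a \<Rightarrow> real"
  assumes indep: "indep_vars (\<lambda>_. borel) X UNIV"
    and ident: "\<And>i. distr M borel (X i) = distr M borel (X 0)"
    and integrable_X0: "integrable M (X 0)"
begin

abbreviation law :: "real measure" where "law \<equiv> distr M borel (X 0)"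

lemma measurable_X [measurable]: "X i \<in> borel_measurable M"
  using indep by (simp add: indep_vars_def2)

lemma real_distribution_law: "real_distribution law"
  by (intro real_distribution_distr) measurable

sublocale law: real_distribution law
  by (rule real_distribution_law)

lemma integrable_law: "integrable law (\<lambda>y. y)"
  using integrable_X0 by (subst integrable_distr_eq) auto

lemma measurable_cdf_law [measurable]: "cdf law \<in> borel_measurable borel"
  by (rule borel_measurable_cdf[OF real_distribution_law])

lemma integral_law_eq:
  fixes f :: "real \<Rightarrow> real"
  assumes [measurable]: "f \<in> borel_measurable borel"
  shows "(\<integral>y. f y \<partial>law) = expectation (\<lambda>\<omega>. f (X i \<omega>))"
  by (subst ident[of i, symmetric], subst integral_distr) auto

lemma integrable_law_iff:
  fixes f :: "real \<Rightarrow> real"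
  assumes [measurable]: "f \<in> borel_measurable borel"
  shows "integrable law f \<longleftrightarrow> integrable M (\<lambda>\<omega>. f (X i \<omega>))"
  by (subst ident[of i, symmetric], subst integrable_distr_eq) auto

lemma expectation_X_le: "expectation (\<lambda>\<omega>. of_bool (X i \<omega> \<le> t)) = cdf law t"
proof -
  have "expectation (\<lambda>\<omega>. of_bool (X i \<omega> \<le> t) :: real) = (\<integral>y. of_bool (y \<le> t) \<partial>law)"
    by (rule integral_law_eq[of "\<lambda>y. of_bool (y \<le> t)" i, symmetric]) measurable
  also have "\<dots> = (\<integral>y. indicator {..t} y \<partial>law)"
    by (intro Bochner_Integration.integral_cong) (auto split: split_indicator)
  also have "\<dots> = cdf law t"
    by (simp add: cdf_def)
  finally show ?thesis .
qed

section \<open>Moments of the empirical distribution function\<close>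

lemma measurable_empirical_cdf [measurable]: "(\<lambda>\<omega>. empirical_cdf X n \<omega> t) \<in> borel_measurable M"
  unfolding empirical_cdf_def by measurable

lemma empirical_cdf_bounds: "0 \<le> empirical_cdf X n \<omega> t" "empirical_cdf X n \<omega> t \<le> 1"
proof -
  have "(\<Sum>i=1..n. of_bool (X i \<omega> \<le> t) :: real) \<le> (\<Sum>i=1..n. 1)"
    by (intro sum_mono) simp
  then show "empirical_cdf X n \<omega> t \<le> 1"
    by (cases "n = 0") (simp_all add: empirical_cdf_def)
  show "0 \<le> empirical_cdf X n \<omega> t"
    unfolding empirical_cdf_def by (intro mult_nonneg_nonneg sum_nonneg) simp_all
qed

lemma integrable_empirical_cdf: "integrable M (\<lambda>\<omega>. empirical_cdf X n \<omega> t)"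
  by (rule integrable_const_bound[of _ 1]) (use empirical_cdf_bounds in auto)

lemma expectation_empirical_cdf:
  assumes "0 < n"
  shows "expectation (\<lambda>\<omega>. empirical_cdf X n \<omega> t) = cdf law t"
proof -
  have "integrable M (\<lambda>\<omega>. of_bool (X i \<omega> \<le> t) :: real)" for i
    by (rule integrable_const_bound[of _ 1]) auto
  then show ?thesis
    using assms by (simp add: empirical_cdf_def expectation_X_le del: sum_of_bool_eq)
qed

text \<open>The deviation is the average of the independent centred indicators \<open>V i\<close>,
  to which the second moment formula for sums applies.\<close>

lemma
  assumes "0 < n"
  shows integrable_empirical_cdf_square: "integrable M (\<lambda>\<omega>. (empirical_cdf X n \<omega> t - cdf law t)\<^sup>2)" (is ?A)
    and variance_empirical_cdf:
      "expectation (\<lambda>\<omega>. (empirical_cdf X n \<omega> t - cdf law t)\<^sup>2) = cdf law t * (1 - cdf law t) / real n" (is ?B)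
proof -
  define V where "V i \<omega> = of_bool (X i \<omega> \<le> t) - cdf law t" for i \<omega>
  have [measurable]: "V i \<in> borel_measurable M" for i
    unfolding V_def by measurable
  have int1: "integrable M (\<lambda>\<omega>. of_bool (X i \<omega> \<le> t) :: real)" for i
    by (rule integrable_const_bound[of _ 1]) auto
  have indepV: "indep_vars (\<lambda>_. borel) V {1..n}"
    unfolding V_def
    by (rule indep_vars_compose2[OF indep_vars_subset[OF indep], of _ "\<lambda>_ x. of_bool (x \<le> t) - cdf law t"]) auto
  \<comment> \<open>An indicator equals its square, so the square of \<open>V i\<close> is affine in
    the indicator.\<close>
  have V2: "(V i \<omega>)\<^sup>2 = (1 - 2 * cdf law t) * of_bool (X i \<omega> \<le> t) + (cdf law t)\<^sup>2" for i \<omega>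
    by (simp add: V_def power2_eq_square algebra_simps)
  have intV2: "integrable M (\<lambda>\<omega>. (V i \<omega>)\<^sup>2)" for i
    unfolding V2 using int1 by simp
  have EV: "expectation (V i) = 0" for i
    unfolding V_def using int1 by (simp add: expectation_X_le prob_space)
  have EV2: "expectation (\<lambda>\<omega>. (V i \<omega>)\<^sup>2) = cdf law t * (1 - cdf law t)" for i
    unfolding V2 using int1
    by (simp add: expectation_X_le prob_space power2_eq_square algebra_simps)
  have eq: "(empirical_cdf X n \<omega> t - cdf law t)\<^sup>2 = (\<Sum>i\<in>{1..n}. V i \<omega>)\<^sup>2 / (real n)\<^sup>2" for \<omega>
  proof -
    have "empirical_cdf X n \<omega> t - cdf law t = (\<Sum>i\<in>{1..n}. V i \<omega>) / real n"
      using assms by (simp add: V_def empirical_cdf_def sum_subtractf field_simps del: sum_of_bool_eq)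
    then show ?thesis by (simp add: power_divide)
  qed
  show ?A
    unfolding eq by (intro integrable_divide integrable_sum_indep_square indepV intV2 EV) simp
  have "expectation (\<lambda>\<omega>. (\<Sum>i\<in>{1..n}. V i \<omega>)\<^sup>2) = real n * (cdf law t * (1 - cdf law t))"
    by (subst expectation_sum_indep_square[OF _ indepV intV2 EV]) (simp_all add: EV2)
  then show ?B
    unfolding eq using assms by (simp add: power2_eq_square)
qed

lemma nn_integral_empirical_cdf_square:
  assumes "0 < n"
  shows "(\<integral>\<^sup>+\<omega>. ennreal ((empirical_cdf X n \<omega> t - cdf law t)\<^sup>2) \<partial>M) = ennreal (cdf law t * (1 - cdf law t) / real n)"
  using integrable_empirical_cdf_square[OF assms] variance_empirical_cdf[OF assms]
  by (subst nn_integral_eq_integral) auto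

text \<open>The first bound gives the rate at each \<open>t\<close>, from the variance. The other
  two follow from the triangle inequality for \<open>F\<close> and for \<open>1 - F\<close>, and are
  integrable near minus and plus infinity respectively.\<close>

lemma expectation_abs_empirical_cdf_le:
  assumes n: "0 < n"
  shows "expectation (\<lambda>\<omega>. \<bar>empirical_cdf X n \<omega> t - cdf law t\<bar>) \<le> 1 / sqrt (real n)" (is "?E \<le> _")
    and "expectation (\<lambda>\<omega>. \<bar>empirical_cdf X n \<omega> t - cdf law t\<bar>) \<le> 2 * cdf law t"
    and "expectation (\<lambda>\<omega>. \<bar>empirical_cdf X n \<omega> t - cdf law t\<bar>) \<le> 2 * (1 - cdf law t)"
proof -
  have F: "0 \<le> cdf law t" "cdf law t \<le> 1"
    by (simp_all add: law.cdf_nonneg law.cdf_bounded_prob)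
  note int = integrable_empirical_cdf[of n t] integrable_empirical_cdf_square[OF n, of t]
  have int_abs: "integrable M (\<lambda>\<omega>. \<bar>empirical_cdf X n \<omega> t - cdf law t\<bar>)"
    using int(1) by (intro integrable_abs Bochner_Integration.integrable_diff) auto
  \<comment> \<open>The arithmetic-geometric mean inequality, weighted for deviations of size
    \<open>1 / sqrt n\<close>; it takes the place of Cauchy-Schwarz.\<close>
  have amgm: "\<bar>v\<bar> \<le> (1 / sqrt (real n) + sqrt (real n) * v\<^sup>2) / 2" for v
  proof -
    have "0 \<le> (1 - sqrt (real n) * \<bar>v\<bar>)\<^sup>2 / sqrt (real n)" by simp
    also have "\<dots> = 1 / sqrt (real n) + sqrt (real n) * v\<^sup>2 - 2 * \<bar>v\<bar>"
      using n by (simp add: power2_eq_square field_simps)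
    finally show ?thesis by simp
  qed
  have "?E \<le> expectation (\<lambda>\<omega>. (1 / sqrt (real n) + sqrt (real n) * (empirical_cdf X n \<omega> t - cdf law t)\<^sup>2) / 2)"
    using int_abs int(2) by (intro integral_mono amgm) auto
  also have "\<dots> = (1 / sqrt (real n) + sqrt (real n) * (cdf law t * (1 - cdf law t) / real n)) / 2"
    using int(2) by (simp add: variance_empirical_cdf[OF n] prob_space)
  also have "sqrt (real n) * (cdf law t * (1 - cdf law t) / real n) = cdf law t * (1 - cdf law t) / sqrt (real n)"
    using n by (rule sqrt_mult_divide)
  also have "\<dots> \<le> 1 * 1 / sqrt (real n)"
    using F by (intro divide_right_mono mult_mono) auto
  finally show "?E \<le> 1 / sqrt (real n)" by simp
  have "?E \<le> expectation (\<lambda>\<omega>. empirical_cdf X n \<omega> t + cdf law t)"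
    using int_abs int(1) F empirical_cdf_bounds
    by (intro integral_mono Bochner_Integration.integrable_add) (auto simp: abs_le_iff intro: order_trans[of _ 0])
  also have "\<dots> = 2 * cdf law t"
    using int(1) by (simp add: expectation_empirical_cdf[OF n] prob_space)
  finally show "?E \<le> 2 * cdf law t" .
  have "?E \<le> expectation (\<lambda>\<omega>. (1 - empirical_cdf X n \<omega> t) + (1 - cdf law t))"
  proof (intro integral_mono int_abs)
    show "integrable M (\<lambda>\<omega>. (1 - empirical_cdf X n \<omega> t) + (1 - cdf law t))"
      using int(1) by simp
    show "\<bar>empirical_cdf X n \<omega> t - cdf law t\<bar> \<le> 1 - empirical_cdf X n \<omega> t + (1 - cdf law t)" for \<omega>
      using empirical_cdf_bounds[of n \<omega> t] F by linarith
  qed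
  also have "\<dots> = 2 * (1 - cdf law t)"
    using int(1) by (simp add: expectation_empirical_cdf[OF n] prob_space)
  finally show "?E \<le> 2 * (1 - cdf law t)" .
qed

lemma nn_integral_abs_empirical_cdf:
  "(\<integral>\<^sup>+\<omega>. ennreal \<bar>empirical_cdf X n \<omega> t - cdf law t\<bar> \<partial>M)
    = ennreal (expectation (\<lambda>\<omega>. \<bar>empirical_cdf X n \<omega> t - cdf law t\<bar>))"
  using integrable_empirical_cdf[of n t]
  by (intro nn_integral_eq_integral integrable_abs Bochner_Integration.integrable_diff) auto

text \<open>The inner integral is the Wasserstein distance of order 1 between the empirical
  distribution and the law. Tonelli moves the expectation inside, and dominated convergence in
  \<open>t\<close> applies.\<close>

lemma tendsto_W1:
  "(\<lambda>n. \<integral>\<^sup>+\<omega>. (\<integral>\<^sup>+t. ennreal \<bar>empirical_cdf X n \<omega> t - cdf law t\<bar> \<partial>lborel) \<partial>M) \<longlonglongrightarrow> 0"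
\<comment> \<open>The moment bounds need a nonempty sample, so the index is shifted by one.\<close>
proof (rule LIMSEQ_imp_Suc)
  interpret P: pair_sigma_finite lborel M ..
  let ?u = "\<lambda>n t. \<integral>\<^sup>+\<omega>. ennreal \<bar>empirical_cdf X (Suc n) \<omega> t - cdf law t\<bar> \<partial>M"
  \<comment> \<open>Twice \<open>F\<close> left of 0 and twice \<open>1 - F\<close> from 0 on; the
    integral is twice the first absolute moment.\<close>
  let ?w = "\<lambda>t. 2 * (ennreal (cdf law t) * indicator {..<0} t) + 2 * (ennreal (1 - cdf law t) * indicator {0..} t)"
  have swap: "(\<integral>\<^sup>+\<omega>. (\<integral>\<^sup>+t. ennreal \<bar>empirical_cdf X n \<omega> t - cdf law t\<bar> \<partial>lborel) \<partial>M)
      = (\<integral>\<^sup>+t. (\<integral>\<^sup>+\<omega>. ennreal \<bar>empirical_cdf X n \<omega> t - cdf law t\<bar> \<partial>M) \<partial>lborel)" for n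
  proof (rule P.Fubini')
    show "(\<lambda>(t, \<omega>). ennreal \<bar>empirical_cdf X n \<omega> t - cdf law t\<bar>) \<in> borel_measurable (lborel \<Otimes>\<^sub>M M)"
      unfolding empirical_cdf_def case_prod_beta by measurable
  qed
  have "(\<lambda>n. \<integral>\<^sup>+t. ?u n t \<partial>lborel) \<longlonglongrightarrow> (\<integral>\<^sup>+t. 0 \<partial>(lborel :: real measure))"
  proof (rule nn_integral_dominated_convergence)
    show "?u n \<in> borel_measurable lborel" for n
      by (rule borel_measurable_nn_integral) (unfold empirical_cdf_def case_prod_beta, measurable)
    show "?w \<in> borel_measurable lborel" by measurable
    show "AE t in lborel. ?u n t \<le> ?w t" for n
    proof (rule AE_I2)
      fix t
      have "ennreal (2 * cdf law t) = 2 * ennreal (cdf law t)"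
        "ennreal (2 * (1 - cdf law t)) = 2 * ennreal (1 - cdf law t)"
        by (simp_all add: ennreal_mult law.cdf_nonneg law.cdf_bounded_prob del: right_diff_distrib_numeral)
      then show "?u n t \<le> ?w t"
        using expectation_abs_empirical_cdf_le(2,3)[of "Suc n" t, THEN ennreal_leI]
        by (cases "t < 0") (auto simp: nn_integral_abs_empirical_cdf)
    qed
    have "(\<integral>\<^sup>+t. ?w t \<partial>lborel) = 2 * (\<integral>\<^sup>+y. ennreal (0 - y) \<partial>law) + 2 * (\<integral>\<^sup>+y. ennreal (y - 0) \<partial>law)"
      by (subst nn_integral_add)
        (simp_all add: nn_integral_cmult nn_integral_cdf_lessThan[OF real_distribution_law]
          nn_integral_cdf_atLeast[OF real_distribution_law])
    also have "\<dots> < \<infinity>"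
      using integrable_law by (simp add: real_integrable_def ennreal_mult_less_top top.not_eq_extremum)
    finally show "(\<integral>\<^sup>+t. ?w t \<partial>lborel) < \<infinity>" .
    show "AE t in lborel. (\<lambda>n. ?u n t) \<longlonglongrightarrow> 0"
    proof (rule AE_I2)
      fix t
      have "(\<lambda>n. ennreal (1 / sqrt (real (Suc n)))) \<longlonglongrightarrow> ennreal 0"
        by (intro tendsto_ennrealI tendsto_divide_0[OF tendsto_const] filterlim_at_top_imp_at_infinity
          filterlim_compose[OF sqrt_at_top] filterlim_compose[OF filterlim_real_sequentially filterlim_Suc])
      then have lim: "(\<lambda>n. ennreal (1 / sqrt (real (Suc n)))) \<longlonglongrightarrow> 0" by simp
      show "(\<lambda>n. ?u n t) \<longlonglongrightarrow> 0"
        by (rule tendsto_sandwich[OF _ _ tendsto_const lim]; intro always_eventually allI)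
          (simp_all add: nn_integral_abs_empirical_cdf ennreal_leI expectation_abs_empirical_cdf_le(1) del: of_nat_Suc)
    qed
  qed simp
  then show "(\<lambda>n. \<integral>\<^sup>+\<omega>. (\<integral>\<^sup>+t. ennreal \<bar>empirical_cdf X (Suc n) \<omega> t - cdf law t\<bar> \<partial>lborel) \<partial>M) \<longlonglongrightarrow> 0"
    unfolding swap by simp
qed

end

section \<open>Bounds on the excess, and the distribution function near a quantile\<close>

lemma excess_nonneg: "0 \<le> excess F p q t"
  by (simp add: excess_def)

text \<open>The excess is positive only if \<open>G t\<close> lies on the other side of
  \<open>p\<close> from \<open>F t\<close>; then \<open>\<bar>G t - F t\<bar>\<close> dominates both
  the excess and \<open>\<bar>F t - p\<bar>\<close>. Multiplying the two estimates gives the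
  quadratic bound.\<close>

lemma excess_le:
  assumes "t \<noteq> q" "q < t \<Longrightarrow> p < F t" "t < q \<Longrightarrow> F t < p"
  shows "excess G p q t \<le> \<bar>G t - F t\<bar>"
    and "excess G p q t \<le> (G t - F t)\<^sup>2 / \<bar>F t - p\<bar>"
proof -
  show 1: "excess G p q t \<le> \<bar>G t - F t\<bar>"
    using assms by (cases "q < t") (auto simp: excess_def)
  have pos: "0 < \<bar>F t - p\<bar>"
    using assms by (cases "q < t") auto
  show "excess G p q t \<le> (G t - F t)\<^sup>2 / \<bar>F t - p\<bar>"
  proof (cases "excess G p q t = 0")
    case False
    then have "\<bar>F t - p\<bar> \<le> \<bar>G t - F t\<bar>"
      using assms by (cases "q < t") (auto simp: excess_def max_def split: if_splits)
    then have "excess G p q t * \<bar>F t - p\<bar> \<le> \<bar>G t - F t\<bar> * \<bar>G t - F t\<bar>"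
      by (intro mult_mono 1) auto
    then show ?thesis
      using pos by (simp add: pos_le_divide_eq power2_eq_square)
  qed simp
qed

lemma cdf_less_of_less_quantile:
  assumes "real_distribution N" "0 < p" "p < 1" "t < real_of_ereal (quantile (cdf N) p)"
  shows "cdf N t < p"
  using quantile_cdf_le_iff[OF assms(1-3), of t] assms(4) by linarith

text \<open>A flat stretch of \<open>F\<close> at level \<open>p\<close> would be a jump of the
  quantile function. For \<open>u\<close> slightly above \<open>p\<close>, continuity keeps the
  quantile below \<open>t\<close>, so \<open>u \<le> F t\<close>, which contradicts
  \<open>F t \<le> p\<close>.\<close>

lemma less_cdf_of_isCont_quantile:
  assumes N: "real_distribution N" and p: "0 < p" "p < 1" and cont: "isCont (quantile (cdf N)) p"
    and t: "real_of_ereal (quantile (cdf N) p) < t"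
  shows "p < cdf N t"
proof (rule ccontr)
  assume "\<not> p < cdf N t"
  have "quantile (cdf N) p < ereal t"
    using t by (simp add: quantile_cdf_eq[OF N p])
  with cont have "\<forall>\<^sub>F u in at p. quantile (cdf N) u < ereal t"
    by (auto simp: isCont_def dest: order_tendstoD(2))
  then have "\<forall>\<^sub>F u in at_right p. quantile (cdf N) u < ereal t"
    by (rule filter_leD[rotated]) (simp add: at_le)
  moreover have "\<forall>\<^sub>F u in at_right p. u < 1 \<and> p < u"
    using eventually_at_right_less[of p] order_tendstoD(2)[OF tendsto_ident_at p(2), of "{p<..}"]
    by eventually_elim simp
  ultimately have "\<forall>\<^sub>F u in at_right p. False"
  proof eventually_elim
    case (elim u)
    then have "real_of_ereal (quantile (cdf N) u) \<le> t"
      using p by (simp add: quantile_cdf_eq[OF N])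
    then have "u \<le> cdf N t"
      using quantile_cdf_le_iff[OF N, of u t] elim p by simp
    then show False using elim \<open>\<not> p < cdf N t\<close> by simp
  qed
  then show False by simp
qed

section \<open>The influence function in closed form\<close>

text \<open>Left of \<open>q\<close> the indicator part lives on \<open>[x, q)\<close> and
  \<open>F\<close> is integrable, so the two parts can be integrated separately.\<close>

lemma LBINT_of_bool_minus_cdf:
  assumes "real_distribution N" "integrable N (\<lambda>y. y)"
  shows "(LBINT t=-\<infinity>..ereal q. of_bool (x \<le> t) - cdf N t) = max 0 (q - x) - (\<integral>y. max 0 (q - y) \<partial>N)"
proof -
  have "einterval (-\<infinity>) (ereal q) = {..<q}"
    by (auto simp: einterval_def)
  then have "(LBINT t=-\<infinity>..ereal q. of_bool (x \<le> t) - cdf N t)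
      = (\<integral>t. indicator {..<q} t * (of_bool (x \<le> t) - cdf N t) \<partial>lborel)"
    by (simp add: interval_lebesgue_integral_def set_lebesgue_integral_def)
  also have "\<dots> = (\<integral>t. indicator {x..<q} t - indicator {..<q} t * cdf N t \<partial>lborel)"
    by (intro Bochner_Integration.integral_cong) (auto split: split_indicator)
  also have "\<dots> = (\<integral>t. indicator {x..<q} t \<partial>lborel) - (\<integral>y. max 0 (q - y) \<partial>N)"
    unfolding integral_cdf_lessThan[OF assms, symmetric]
    by (rule Bochner_Integration.integral_diff[OF integrable_indicator_bounded integrable_cdf_lessThan[OF assms]]) auto
  also have "(\<integral>t. indicator {x..<q} t \<partial>lborel) = max 0 (q - x)"
    by (cases "x \<le> q") auto
  finally show ?thesis .
qed

text \<open>In this form the zero mean and the linear growth in \<open>x\<close> are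
  visible.\<close>

lemma GC_influence_eq:
  assumes N: "real_distribution N" "integrable N (\<lambda>y. y)" and p: "0 < p" "p < 1"
  defines "q \<equiv> real_of_ereal (quantile (cdf N) p)" and "q' \<equiv> real_of_ereal (quantile (cdf N) (1 - p))"
  shows "GC_influence (cdf N) m p x = ((max 0 (q' - x) - (\<integral>y. max 0 (q' - y) \<partial>N))
    + (max 0 (q - x) - (\<integral>y. max 0 (q - y) \<partial>N)) + (1 - GC (cdf N) m p) * (x - m)) / m"
proof -
  have "quantile (cdf N) p = ereal q" "quantile (cdf N) (1 - p) = ereal q'"
    using p by (simp_all add: q_def q'_def quantile_cdf_eq[OF N(1)])
  then show ?thesis
    by (simp add: GC_influence_def LBINT_of_bool_minus_cdf[OF N] add_divide_distrib)
qed

context iid_sample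
begin

section \<open>The integrated excess is of smaller order than \<open>1 / sqrt n\<close>\<close>

text \<open>The linear bound on the excess meets a mean deviation of order \<open>1 / sqrt n\<close>
  and leaves a constant; the quadratic one meets a variance of order \<open>1 / n\<close> and leaves
  a factor tending to 0.\<close>

lemma nn_integral_sqrt_excess_le:
  assumes n: "0 < n" and t: "t \<noteq> q" "q < t \<Longrightarrow> p < cdf law t" "t < q \<Longrightarrow> cdf law t < p"
  shows "(\<integral>\<^sup>+\<omega>. ennreal (sqrt (real n) * excess (empirical_cdf X n \<omega>) p q t) \<partial>M) \<le> 1" (is "?E \<le> _")
    and "(\<integral>\<^sup>+\<omega>. ennreal (sqrt (real n) * excess (empirical_cdf X n \<omega>) p q t) \<partial>M)
      \<le> ennreal (cdf law t * (1 - cdf law t) / \<bar>cdf law t - p\<bar> / sqrt (real n))"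
proof -
  have "?E \<le> (\<integral>\<^sup>+\<omega>. ennreal (sqrt (real n)) * ennreal \<bar>empirical_cdf X n \<omega> t - cdf law t\<bar> \<partial>M)"
    by (intro nn_integral_mono)
      (auto simp: ennreal_mult[symmetric] intro!: ennreal_leI mult_left_mono excess_le(1)[where F = "cdf law", OF t])
  also have "\<dots> = ennreal (sqrt (real n)) * ennreal (expectation (\<lambda>\<omega>. \<bar>empirical_cdf X n \<omega> t - cdf law t\<bar>))"
    by (subst nn_integral_cmult) (simp_all add: nn_integral_abs_empirical_cdf)
  also have "\<dots> \<le> ennreal (sqrt (real n)) * ennreal (1 / sqrt (real n))"
    by (intro mult_left_mono ennreal_leI expectation_abs_empirical_cdf_le(1) n) simp
  also have "\<dots> = 1"
    using n by (simp add: ennreal_mult[symmetric])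
  finally show "?E \<le> 1" .
  have "?E \<le> (\<integral>\<^sup>+\<omega>. ennreal (sqrt (real n) / \<bar>cdf law t - p\<bar>) * ennreal ((empirical_cdf X n \<omega> t - cdf law t)\<^sup>2) \<partial>M)"
  proof (intro nn_integral_mono)
    fix \<omega>
    have "sqrt (real n) * excess (empirical_cdf X n \<omega>) p q t
        \<le> sqrt (real n) * ((empirical_cdf X n \<omega> t - cdf law t)\<^sup>2 / \<bar>cdf law t - p\<bar>)"
      by (intro mult_left_mono excess_le(2)[where F = "cdf law", OF t]) auto
    then show "ennreal (sqrt (real n) * excess (empirical_cdf X n \<omega>) p q t)
        \<le> ennreal (sqrt (real n) / \<bar>cdf law t - p\<bar>) * ennreal ((empirical_cdf X n \<omega> t - cdf law t)\<^sup>2)"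
      by (simp add: ennreal_mult[symmetric] ennreal_leI)
  qed
  also have "\<dots> = ennreal (sqrt (real n) / \<bar>cdf law t - p\<bar>) * ennreal (cdf law t * (1 - cdf law t) / real n)"
    by (subst nn_integral_cmult) (simp_all add: nn_integral_empirical_cdf_square[OF n])
  also have "\<dots> = ennreal (sqrt (real n) * (cdf law t * (1 - cdf law t) / real n) / \<bar>cdf law t - p\<bar>)"
    by (simp add: ennreal_mult[symmetric] law.cdf_nonneg law.cdf_bounded_prob)
  also have "\<dots> = ennreal (cdf law t * (1 - cdf law t) / \<bar>cdf law t - p\<bar> / sqrt (real n))"
    by (simp only: sqrt_mult_divide[OF n] divide_divide_eq_left mult.commute)
  finally show "?E \<le> ennreal (cdf law t * (1 - cdf law t) / \<bar>cdf law t - p\<bar> / sqrt (real n))" .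
qed

text \<open>The first bound alone is not integrable, nor need \<open>\<surd>(F(1 - F))\<close> be; away from \<open>q\<close> the second
  bound is dominated by a multiple of the integrable tails \<open>F\<close> and \<open>1 - F\<close>.\<close>

lemma tendsto_sqrt_excess:
  assumes above: "\<And>t. q < t \<Longrightarrow> p < cdf law t" and below: "\<And>t. t < q \<Longrightarrow> cdf law t < p"
  shows "(\<lambda>n. \<integral>\<^sup>+\<omega>. (\<integral>\<^sup>+t. ennreal (sqrt (real n) * excess (empirical_cdf X n \<omega>) p q t) \<partial>lborel) \<partial>M)
    \<longlonglongrightarrow> 0"
proof (rule LIMSEQ_imp_Suc)
  interpret P: pair_sigma_finite lborel M ..
  let ?F = "cdf law"
  let ?u = "\<lambda>n t. \<integral>\<^sup>+\<omega>. ennreal (sqrt (real (Suc n)) * excess (empirical_cdf X (Suc n) \<omega>) p q t) \<partial>M"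
  \<comment> \<open>The constants are reciprocals of the distance of \<open>F\<close> from
    \<open>p\<close> at \<open>q - 1\<close> and \<open>q + 1\<close>, positive by
    \<open>below\<close> and \<open>above\<close>. By monotonicity of \<open>F\<close> the distance
    is at least as large beyond these points.\<close>
  let ?w = "\<lambda>t. indicator {q - 1..q + 1} t
    + ennreal (1 / (p - ?F (q - 1))) * (ennreal (?F t) * indicator {..<q - 1} t)
    + ennreal (1 / (?F (q + 1) - p)) * (ennreal (1 - ?F t) * indicator {q + 1..} t)"
  have F: "0 \<le> ?F t" "?F t \<le> 1" for t
    by (simp_all add: law.cdf_nonneg law.cdf_bounded_prob)
  have swap: "(\<integral>\<^sup>+\<omega>. (\<integral>\<^sup>+t. ennreal (sqrt (real n) * excess (empirical_cdf X n \<omega>) p q t) \<partial>lborel) \<partial>M)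
      = (\<integral>\<^sup>+t. (\<integral>\<^sup>+\<omega>. ennreal (sqrt (real n) * excess (empirical_cdf X n \<omega>) p q t) \<partial>M) \<partial>lborel)" for n
  proof (rule P.Fubini')
    show "(\<lambda>(t, \<omega>). ennreal (sqrt (real n) * excess (empirical_cdf X n \<omega>) p q t)) \<in> borel_measurable (lborel \<Otimes>\<^sub>M M)"
      unfolding empirical_cdf_def excess_def case_prod_beta by measurable
  qed
  have "(\<lambda>n. \<integral>\<^sup>+t. ?u n t \<partial>lborel) \<longlonglongrightarrow> (\<integral>\<^sup>+t. 0 \<partial>(lborel :: real measure))"
  proof (rule nn_integral_dominated_convergence)
    show "?u n \<in> borel_measurable lborel" for n
      by (rule borel_measurable_nn_integral) (unfold empirical_cdf_def excess_def case_prod_beta, measurable)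
    show "?w \<in> borel_measurable lborel" by measurable
    show "AE t in lborel. ?u n t \<le> ?w t" for n
      \<comment> \<open>At \<open>t = q\<close> the sign of \<open>F t - p\<close> is not
        controlled; this point is a null set.\<close>
      using AE_lborel_singleton[of q]
    proof eventually_elim
      case (elim t)
      have bound: "?u n t \<le> 1" "?u n t \<le> ennreal (?F t * (1 - ?F t) / \<bar>?F t - p\<bar> / sqrt (real (Suc n)))"
        by (rule nn_integral_sqrt_excess_le[OF zero_less_Suc]; fact elim above below)+
      have sqrt: "1 \<le> sqrt (real (Suc n))" by simp
      consider "q - 1 \<le> t" "t \<le> q + 1" | "t < q - 1" | "q + 1 < t" by linarith
      then show ?case
      proof cases
        case 1
        then have "(1::ennreal) \<le> ?w t" by (simp add: add.assoc)
        with bound(1) show ?thesis by (rule order_trans)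
      next
        case 2
        have "?F t \<le> ?F (q - 1)" using 2 by (intro law.cdf_nondecreasing) simp
        moreover have "?F (q - 1) < p" by (rule below) simp
        ultimately have "?F t * (1 - ?F t) / \<bar>?F t - p\<bar> / sqrt (real (Suc n)) \<le> ?F t * 1 / (p - ?F (q - 1)) / 1"
          using F[of t] sqrt by (intro frac_le mult_left_mono divide_nonneg_nonneg mult_nonneg_nonneg) auto
        then have "ennreal (?F t * (1 - ?F t) / \<bar>?F t - p\<bar> / sqrt (real (Suc n))) \<le> ennreal (1 / (p - ?F (q - 1))) * ennreal (?F t)"
          using F[of t] \<open>?F (q - 1) < p\<close> by (simp add: ennreal_mult[symmetric] ennreal_leI)
        also have "\<dots> \<le> ?w t" using 2 by simp
        finally have "ennreal (?F t * (1 - ?F t) / \<bar>?F t - p\<bar> / sqrt (real (Suc n))) \<le> ?w t" .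
        with bound(2) show ?thesis by (rule order_trans)
      next
        case 3
        have "?F (q + 1) \<le> ?F t" using 3 by (intro law.cdf_nondecreasing) simp
        moreover have "p < ?F (q + 1)" by (rule above) simp
        ultimately have "?F t * (1 - ?F t) / \<bar>?F t - p\<bar> / sqrt (real (Suc n)) \<le> 1 * (1 - ?F t) / (?F (q + 1) - p) / 1"
          using F[of t] sqrt by (intro frac_le mult_right_mono divide_nonneg_nonneg mult_nonneg_nonneg) auto
        then have "ennreal (?F t * (1 - ?F t) / \<bar>?F t - p\<bar> / sqrt (real (Suc n))) \<le> ennreal (1 / (?F (q + 1) - p)) * ennreal (1 - ?F t)"
          using F[of t] \<open>p < ?F (q + 1)\<close> by (simp add: ennreal_mult[symmetric] ennreal_leI)
        also have "\<dots> \<le> ?w t" using 3 by simp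
        finally have "ennreal (?F t * (1 - ?F t) / \<bar>?F t - p\<bar> / sqrt (real (Suc n))) \<le> ?w t" .
        with bound(2) show ?thesis by (rule order_trans)
      qed
    qed
    have "(\<integral>\<^sup>+t. ?w t \<partial>lborel) = emeasure lborel {q - 1..q + 1}
        + ennreal (1 / (p - ?F (q - 1))) * (\<integral>\<^sup>+y. ennreal (q - 1 - y) \<partial>law)
        + ennreal (1 / (?F (q + 1) - p)) * (\<integral>\<^sup>+y. ennreal (y - (q + 1)) \<partial>law)"
      by (simp add: nn_integral_add nn_integral_cmult nn_integral_cdf_lessThan[OF real_distribution_law]
          nn_integral_cdf_atLeast[OF real_distribution_law])
    also have "\<dots> < \<infinity>"
    proof -
      have "integrable law (\<lambda>y. q - 1 - y)" "integrable law (\<lambda>y. y - (q + 1))"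
        using integrable_law by auto
      then have "(\<integral>\<^sup>+y. ennreal (q - 1 - y) \<partial>law) < \<infinity>" "(\<integral>\<^sup>+y. ennreal (y - (q + 1)) \<partial>law) < \<infinity>"
        unfolding real_integrable_def by (simp_all add: top.not_eq_extremum)
      then show ?thesis by (simp add: ennreal_mult_less_top)
    qed
    finally show "(\<integral>\<^sup>+t. ?w t \<partial>lborel) < \<infinity>" .
    show "AE t in lborel. (\<lambda>n. ?u n t) \<longlonglongrightarrow> 0"
      using AE_lborel_singleton[of q]
    proof eventually_elim
      case (elim t)
      have "(\<lambda>n. ennreal (?F t * (1 - ?F t) / \<bar>?F t - p\<bar> / sqrt (real (Suc n)))) \<longlonglongrightarrow> ennreal 0"
        by (intro tendsto_ennrealI tendsto_divide_0[OF tendsto_const] filterlim_at_top_imp_at_infinity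
          filterlim_compose[OF sqrt_at_top] filterlim_compose[OF filterlim_real_sequentially filterlim_Suc])
      then have lim: "(\<lambda>n. ennreal (?F t * (1 - ?F t) / \<bar>?F t - p\<bar> / sqrt (real (Suc n)))) \<longlonglongrightarrow> 0" by simp
      have le: "?u n t \<le> ennreal (?F t * (1 - ?F t) / \<bar>?F t - p\<bar> / sqrt (real (Suc n)))" for n
        by (rule nn_integral_sqrt_excess_le(2)[OF zero_less_Suc]; fact elim above below)
      show ?case
        by (rule tendsto_sandwich[OF _ _ tendsto_const lim]; intro always_eventually allI le) simp
    qed
  qed simp
  then show "(\<lambda>n. \<integral>\<^sup>+\<omega>. (\<integral>\<^sup>+t. ennreal (sqrt (real (Suc n)) * excess (empirical_cdf X (Suc n) \<omega>) p q t) \<partial>lborel) \<partial>M) \<longlonglongrightarrow> 0"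
    unfolding swap by simp
qed

end

section \<open>Consistency of the sample mean, the lower tails and the index\<close>

context iid_sample
begin

text \<open>The weak law of large numbers, as a consequence of convergence in Wasserstein
  distance.\<close>

lemma tendsto_sample_mean:
  "tendsto_in_probability M (sample_mean X) (\<lambda>_. \<integral>y. y \<partial>law)"
proof (rule tendsto_in_probabilityI_nn_integral[OF _ _ _ tendsto_W1])
  fix n :: nat assume n: "0 < n"
  show "(\<integral>\<^sup>+\<omega>. ennreal \<bar>sample_mean X n \<omega> - (\<integral>y. y \<partial>law)\<bar> \<partial>M)
      \<le> (\<integral>\<^sup>+\<omega>. (\<integral>\<^sup>+t. ennreal \<bar>empirical_cdf X n \<omega> t - cdf law t\<bar> \<partial>lborel) \<partial>M)"
    using expectation_diff_le[OF real_distribution_empirical[OF n] integrable_empirical[OF n]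
        real_distribution_law integrable_law, of X]
    by (intro nn_integral_mono) (simp add: expectation_empirical[OF n] cdf_empirical[OF n])
qed measurable

lemma tendsto_sample_lower_tail:
  assumes p: "0 < p" "p < 1"
  shows "tendsto_in_probability M (\<lambda>n. sample_lower_tail X n p) (\<lambda>_. lower_tail law p)"
proof (rule tendsto_in_probabilityI_nn_integral[OF _ _ _ tendsto_W1])
  fix n :: nat assume n: "0 < n"
  show "(\<integral>\<^sup>+\<omega>. ennreal \<bar>sample_lower_tail X n p \<omega> - lower_tail law p\<bar> \<partial>M)
      \<le> (\<integral>\<^sup>+\<omega>. (\<integral>\<^sup>+t. ennreal \<bar>empirical_cdf X n \<omega> t - cdf law t\<bar> \<partial>lborel) \<partial>M)"
    using lower_tail_diff_le[OF real_distribution_empirical[OF n] integrable_empirical[OF n]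
        real_distribution_law integrable_law p, of X]
    by (intro nn_integral_mono) (simp add: lower_tail_empirical[OF n p] cdf_empirical[OF n])
qed measurable

text \<open>The index is a quotient of the mean and the lower tails, continuous where the mean is
  nonzero.\<close>

lemma tendsto_empirical_GC:
  assumes p: "0 < p" "p < 1" and nz: "(\<integral>y. y \<partial>law) \<noteq> 0"
  shows "tendsto_in_probability M (\<lambda>n. empirical_GC X n p) (\<lambda>_. GC (cdf law) (\<integral>y. y \<partial>law) p)"
proof -
  let ?m = "\<integral>y. y \<partial>law" and ?S = "\<lambda>n \<omega>. sample_lower_tail X n (1 - p) \<omega> + sample_lower_tail X n p \<omega>"
  have p': "0 < 1 - p" "1 - p < 1" using p by auto
  have S: "tendsto_in_probability M ?S (\<lambda>_. lower_tail law (1 - p) + lower_tail law p)"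
    using tendsto_in_probability_isCont2[OF tendsto_sample_lower_tail[OF p'] tendsto_sample_lower_tail[OF p],
        of "\<lambda>z. fst z + snd z"]
    by simp
  have "isCont (\<lambda>z. (fst z - snd z) / fst z) (?m, lower_tail law (1 - p) + lower_tail law p)"
    using nz by (intro continuous_intros) auto
  from tendsto_in_probability_isCont2[OF tendsto_sample_mean S this]
  have "tendsto_in_probability M (\<lambda>n \<omega>. (sample_mean X n \<omega> - ?S n \<omega>) / sample_mean X n \<omega>)
      (\<lambda>_. (?m - (lower_tail law (1 - p) + lower_tail law p)) / ?m)"
    by simp
  moreover have "(\<lambda>n. empirical_GC X n p) = (\<lambda>n \<omega>. (sample_mean X n \<omega> - ?S n \<omega>) / sample_mean X n \<omega>)"
    by (intro ext empirical_GC_eq p)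
  ultimately show ?thesis
    by (simp add: GC_cdf_eq[OF real_distribution_law integrable_law p])
qed

section \<open>Linearisation of the lower tail\<close>

text \<open>The error made when the maximum in the variational formula is replaced by its value at a
  fixed \<open>q\<close>; that value is a sample average.\<close>

definition lower_tail_remainder :: "real \<Rightarrow> real \<Rightarrow> nat \<Rightarrow> 'a \<Rightarrow> real" where
  "lower_tail_remainder p q n \<omega> =
    sample_lower_tail X n p \<omega> - (p * q - (\<Sum>i=1..n. max 0 (q - X i \<omega>)) / real n)"

lemma measurable_lower_tail_remainder [measurable]: "lower_tail_remainder p q n \<in> borel_measurable M"
  unfolding lower_tail_remainder_def by measurable

text \<open>The remainder is nonnegative, since a maximum dominates each value, and at most the
  integrated excess. Continuity at \<open>p\<close> provides the strict signs under which that
  integral vanishes at rate \<open>sqrt n\<close> in mean.\<close>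

lemma tendsto_lower_tail_remainder:
  assumes p: "0 < p" "p < 1" and cont: "isCont (quantile (cdf law)) p"
  defines "q \<equiv> real_of_ereal (quantile (cdf law) p)"
  shows "tendsto_in_probability M (\<lambda>n \<omega>. sqrt (real n) * lower_tail_remainder p q n \<omega>) (\<lambda>_. 0)"
proof (rule tendsto_in_probabilityI_nn_integral)
  show "(\<lambda>n. \<integral>\<^sup>+\<omega>. (\<integral>\<^sup>+t. ennreal (sqrt (real n) * excess (empirical_cdf X n \<omega>) p q t) \<partial>lborel) \<partial>M)
      \<longlonglongrightarrow> 0"
    using less_cdf_of_isCont_quantile[OF real_distribution_law p cont]
      cdf_less_of_less_quantile[OF real_distribution_law p]
    unfolding q_def by (rule tendsto_sqrt_excess)
  fix n :: nat assume n: "0 < n"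
  show "(\<integral>\<^sup>+\<omega>. ennreal \<bar>sqrt (real n) * lower_tail_remainder p q n \<omega> - 0\<bar> \<partial>M)
     \<le> (\<integral>\<^sup>+\<omega>. (\<integral>\<^sup>+t. ennreal (sqrt (real n) * excess (empirical_cdf X n \<omega>) p q t) \<partial>lborel) \<partial>M)"
  proof (rule nn_integral_mono)
    fix \<omega>
    let ?E = "empirical_distribution X n \<omega>"
    have E: "real_distribution ?E" "integrable ?E (\<lambda>y. y)"
      by (auto intro: real_distribution_empirical integrable_empirical n)
    have int: "(\<integral>y. max 0 (q - y) \<partial>?E) = (\<Sum>i=1..n. max 0 (q - X i \<omega>)) / real n"
      by (rule integral_empirical[OF n]) simp
    have [measurable]: "empirical_cdf X n \<omega> \<in> borel_measurable borel"
      using borel_measurable_cdf[OF E(1)] by (simp add: cdf_empirical[OF n])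
    have nonneg: "0 \<le> lower_tail_remainder p q n \<omega>"
      using lower_tail_ge[OF E p, of q]
      by (simp add: lower_tail_remainder_def int lower_tail_empirical[OF n p])
    have "ennreal (lower_tail_remainder p q n \<omega>) \<le> (\<integral>\<^sup>+t. ennreal (excess (empirical_cdf X n \<omega>) p q t) \<partial>lborel)"
      using lower_tail_remainder_le[OF E p, of q]
      by (simp add: lower_tail_remainder_def int lower_tail_empirical[OF n p] cdf_empirical[OF n])
    then have "ennreal (sqrt (real n)) * ennreal (lower_tail_remainder p q n \<omega>)
        \<le> ennreal (sqrt (real n)) * (\<integral>\<^sup>+t. ennreal (excess (empirical_cdf X n \<omega>) p q t) \<partial>lborel)"
      by (rule mult_left_mono) simp
    also have "\<dots> = (\<integral>\<^sup>+t. ennreal (sqrt (real n)) * ennreal (excess (empirical_cdf X n \<omega>) p q t) \<partial>lborel)"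
      by (rule nn_integral_cmult[symmetric]) (unfold excess_def, measurable)
    finally show "ennreal \<bar>sqrt (real n) * lower_tail_remainder p q n \<omega> - 0\<bar>
        \<le> (\<integral>\<^sup>+t. ennreal (sqrt (real n) * excess (empirical_cdf X n \<omega>) p q t) \<partial>lborel)"
      using nonneg by (simp add: ennreal_mult[symmetric] excess_nonneg abs_mult)
  qed
qed measurable

section \<open>Asymptotic normality of the index\<close>

context
  fixes p :: real
  assumes p: "0 < p" "p < 1" and nz: "(\<integral>y. y \<partial>law) \<noteq> 0" and sq: "integrable M (\<lambda>\<omega>. (X 0 \<omega>)\<^sup>2)"
begin

abbreviation "m \<equiv> \<integral>y. y \<partial>law"
abbreviation "influence \<equiv> GC_influence (cdf law) m p"
abbreviation "q \<equiv> real_of_ereal (quantile (cdf law) p)"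
abbreviation "q' \<equiv> real_of_ereal (quantile (cdf law) (1 - p))"
abbreviation "c \<equiv> \<integral>y. max 0 (q - y) \<partial>law"
abbreviation "c' \<equiv> \<integral>y. max 0 (q' - y) \<partial>law"
abbreviation "G \<equiv> GC (cdf law) m p"

lemma influence_eq: "influence x = ((max 0 (q' - x) - c') + (max 0 (q - x) - c) + (1 - G) * (x - m)) / m"
  by (rule GC_influence_eq[OF real_distribution_law integrable_law p])

lemma measurable_influence [measurable]: "influence \<in> borel_measurable borel"
  unfolding influence_eq[abs_def] by measurable

text \<open>Positive parts grow at most linearly, so the influence is at most
  \<open>A + B * \<bar>x\<bar>\<close> and a finite second moment of \<open>X 0\<close>
  suffices.\<close>

lemma integrable_influence_square: "integrable M (\<lambda>\<omega>. (influence (X i \<omega>))\<^sup>2)"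
proof -
  define A B where "A = (\<bar>q'\<bar> + \<bar>c'\<bar> + \<bar>q\<bar> + \<bar>c\<bar> + \<bar>1 - G\<bar> * \<bar>m\<bar>) / \<bar>m\<bar>" and "B = (2 + \<bar>1 - G\<bar>) / \<bar>m\<bar>"
  have lin: "\<bar>influence x\<bar> \<le> A + B * \<bar>x\<bar>" for x
  proof -
    have "\<bar>(1 - G) * (x - m)\<bar> \<le> \<bar>1 - G\<bar> * (\<bar>x\<bar> + \<bar>m\<bar>)"
      unfolding abs_mult by (intro mult_left_mono) auto
    moreover have tri: "\<bar>max 0 (s - x) - d\<bar> \<le> \<bar>s\<bar> + \<bar>x\<bar> + \<bar>d\<bar>" for s d
      by linarith
    have "\<bar>u + v + w\<bar> \<le> \<bar>u\<bar> + \<bar>v\<bar> + \<bar>w\<bar>" for u v w :: real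
      by linarith
    note this[of "max 0 (q' - x) - c'" "max 0 (q - x) - c" "(1 - G) * (x - m)"] tri[of q' c'] tri[of q c]
    ultimately have "\<bar>(max 0 (q' - x) - c') + (max 0 (q - x) - c) + (1 - G) * (x - m)\<bar>
        \<le> \<bar>q'\<bar> + \<bar>c'\<bar> + \<bar>q\<bar> + \<bar>c\<bar> + \<bar>1 - G\<bar> * \<bar>m\<bar> + (2 + \<bar>1 - G\<bar>) * \<bar>x\<bar>"
      unfolding distrib_left distrib_right by linarith
    then show ?thesis
      unfolding influence_eq abs_divide A_def B_def times_divide_eq_left add_divide_distrib[symmetric]
      by (intro divide_right_mono) auto
  qed
  have "integrable law (\<lambda>y. 2 * A\<^sup>2 + 2 * B\<^sup>2 * y\<^sup>2)"
    using sq by (intro Bochner_Integration.integrable_add integrable_mult_right)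
      (auto simp: integrable_distr_eq law.emeasure_space_1)
  then have "integrable law (\<lambda>y. (influence y)\<^sup>2)"
  proof (rule Bochner_Integration.integrable_bound)
    show "AE y in law. norm ((influence y)\<^sup>2) \<le> norm (2 * A\<^sup>2 + 2 * B\<^sup>2 * y\<^sup>2)"
    proof (rule AE_I2)
      fix y
      have "(influence y)\<^sup>2 \<le> (A + B * \<bar>y\<bar>)\<^sup>2"
        using lin[of y] by (metis abs_ge_zero power2_abs power_mono)
      \<comment> \<open>The difference of the two sides is the square of
        \<open>A - B * \<bar>y\<bar>\<close>.\<close>
      also have "\<dots> \<le> 2 * A\<^sup>2 + 2 * B\<^sup>2 * y\<^sup>2"
        using zero_le_power2[of "A - B * \<bar>y\<bar>"] by (simp add: power2_eq_square algebra_simps)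
      finally show "norm ((influence y)\<^sup>2) \<le> norm (2 * A\<^sup>2 + 2 * B\<^sup>2 * y\<^sup>2)" by simp
    qed
  qed measurable
  then show ?thesis
    using integrable_law_iff[of "\<lambda>y. (influence y)\<^sup>2" i] by simp
qed

lemma integrable_influence: "integrable M (\<lambda>\<omega>. influence (X i \<omega>))"
  by (rule square_integrable_imp_integrable[OF _ integrable_influence_square]) measurable

lemma expectation_influence: "expectation (\<lambda>\<omega>. influence (X i \<omega>)) = 0"
proof -
  have int: "integrable law (\<lambda>y. max 0 (x - y))" for x
    by (rule integrable_max_distribution[OF real_distribution_law integrable_law p])
  have "(\<integral>y. influence y \<partial>law) = 0"
    unfolding influence_eq using int[of q] int[of q'] integrable_law law.prob_space by simp
  then show ?thesis
    using integral_law_eq[of influence i] by simp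
qed

text \<open>The central limit theorem counts from 0 and the sample from 1, hence the
  \<open>Suc\<close>.\<close>

definition normed_sum :: "nat \<Rightarrow> 'a \<Rightarrow> real" where
  "normed_sum n \<omega> = (\<Sum>i<n. influence (X (Suc i) \<omega>)) / sqrt (real n)"

lemma measurable_normed_sum [measurable]: "normed_sum n \<in> borel_measurable M"
  unfolding normed_sum_def by measurable

text \<open>The reindexing is done by grouping the family into the disjoint singleton blocks
  \<open>{Suc j}\<close> and composing with the evaluation of each block.\<close>

lemma indep_influence: "indep_vars (\<lambda>_. borel) (\<lambda>i \<omega>. influence (X (Suc i) \<omega>)) UNIV"
proof -
  have "indep_vars (\<lambda>j. PiM {Suc j} (\<lambda>_. borel)) (\<lambda>j \<omega>. restrict (\<lambda>i. X i \<omega>) {Suc j}) UNIV"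
    by (rule indep_vars_restrict[OF indep]) (auto simp: disjoint_family_on_def)
  then have "indep_vars (\<lambda>_. borel) (\<lambda>j \<omega>. influence (restrict (\<lambda>i. X i \<omega>) {Suc j} (Suc j))) UNIV"
    by (rule indep_vars_compose2[where Y = "\<lambda>j f. influence (f (Suc j))"]) measurable
  then show ?thesis by simp
qed

lemma expectation_influence_square:
  "expectation (\<lambda>\<omega>. (influence (X i \<omega>))\<^sup>2) = expectation (\<lambda>\<omega>. (influence (X 0 \<omega>))\<^sup>2)"
  using integral_law_eq[of "\<lambda>y. (influence y)\<^sup>2" i] integral_law_eq[of "\<lambda>y. (influence y)\<^sup>2" 0] by simp

lemma weak_conv_normed_sum:
  "weak_conv_m (\<lambda>n. distr M borel (normed_sum n))
    (normal_distribution 0 (expectation (\<lambda>\<omega>. (influence (X 0 \<omega>))\<^sup>2)))"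
  unfolding normed_sum_def
proof (rule central_limit_theorem_normal_distribution[OF indep_influence expectation_influence
      integrable_influence_square expectation_influence_square])
  have "distr M borel (\<lambda>\<omega>. influence (X j \<omega>)) = distr (distr M borel (X j)) borel influence" for j
    by (subst distr_distr) (auto simp: comp_def)
  then show "distr M borel (\<lambda>\<omega>. influence (X (Suc i) \<omega>)) = distr law borel influence" for i
    by (simp only: ident[of "Suc i"])
qed

text \<open>The bound is uniform in \<open>n\<close>, as required for the product with a null
  sequence.\<close>

lemma
  shows integrable_normed_sum_square: "integrable M (\<lambda>\<omega>. (normed_sum n \<omega>)\<^sup>2)"
    and expectation_normed_sum_square_le:
      "expectation (\<lambda>\<omega>. (normed_sum n \<omega>)\<^sup>2) \<le> expectation (\<lambda>\<omega>. (influence (X 0 \<omega>))\<^sup>2)"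
proof -
  have eq: "(normed_sum n \<omega>)\<^sup>2 = (\<Sum>i<n. influence (X (Suc i) \<omega>))\<^sup>2 / real n" for \<omega>
    by (simp add: normed_sum_def power_divide)
  have ind: "indep_vars (\<lambda>_. borel) (\<lambda>i \<omega>. influence (X (Suc i) \<omega>)) {..<n}"
    by (rule indep_vars_subset[OF indep_influence]) simp
  show "integrable M (\<lambda>\<omega>. (normed_sum n \<omega>)\<^sup>2)"
    unfolding eq
    by (intro integrable_divide integrable_sum_indep_square[OF _ ind] integrable_influence_square expectation_influence) simp
  have "expectation (\<lambda>\<omega>. (\<Sum>i<n. influence (X (Suc i) \<omega>))\<^sup>2)
      = (\<Sum>i<n. expectation (\<lambda>\<omega>. (influence (X (Suc i) \<omega>))\<^sup>2))"
    by (intro expectation_sum_indep_square[OF _ ind] integrable_influence_square expectation_influence) simp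
  also have "\<dots> = real n * expectation (\<lambda>\<omega>. (influence (X 0 \<omega>))\<^sup>2)"
    by (simp only: expectation_influence_square[of "Suc _"] sum_constant card_lessThan)
  finally show "expectation (\<lambda>\<omega>. (normed_sum n \<omega>)\<^sup>2) \<le> expectation (\<lambda>\<omega>. (influence (X 0 \<omega>))\<^sup>2)"
    unfolding eq by (cases "n = 0") simp_all
qed

text \<open>An exact identity, with no expansion of the quotient: if \<open>S\<close> and
  \<open>T\<close> are the sums of the true and the empirical lower tails, the difference of the
  indices is \<open>S / m - T / ?m\<close>, that is \<open>(S * ?m / m - T) / ?m\<close>, and the
  bracket is linear in the sample up to the two remainders.\<close>

lemma normed_empirical_GC_eq:
  assumes n: "0 < n" and mean: "sample_mean X n \<omega> \<noteq> 0"
  shows "sqrt (real n) * (empirical_GC X n p \<omega> - G) = m / sample_mean X n \<omega> *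
    (normed_sum n \<omega> - (sqrt (real n) * lower_tail_remainder (1 - p) q' n \<omega> + sqrt (real n) * lower_tail_remainder p q n \<omega>) / m)"
proof -
  define a where "a x = (\<Sum>i=1..n. max 0 (x - X i \<omega>)) / real n" for x
  let ?m = "sample_mean X n \<omega>"
  let ?R = "lower_tail_remainder p q n \<omega>" and ?R' = "lower_tail_remainder (1 - p) q' n \<omega>"
  let ?S = "lower_tail law (1 - p) + lower_tail law p"
  let ?T = "sample_lower_tail X n (1 - p) \<omega> + sample_lower_tail X n p \<omega>"
  have p': "0 < 1 - p" "1 - p < 1" using p by auto
  have "(\<Sum>i=1..n. influence (X i \<omega>)) = real n * (((a q' - c') + (a q - c) + (1 - G) * (?m - m)) / m)"
    using n nz
    by (simp add: influence_eq a_def sample_mean_def sum_divide_distrib[symmetric] sum.distrib sum_subtractf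
        sum_distrib_left[symmetric] sum_distrib_right[symmetric] field_simps)
  moreover have "(\<Sum>i<n. influence (X (Suc i) \<omega>)) = (\<Sum>i=1..n. influence (X i \<omega>))"
    by (simp add: sum.atLeast1_atMost_eq)
  moreover have "real n * z / sqrt (real n) = sqrt (real n) * z" for z
    using real_div_sqrt[of "real n"] by (metis of_nat_0_le_iff times_divide_eq_left)
  ultimately have sum: "normed_sum n \<omega> = sqrt (real n) * (((a q' - c') + (a q - c) + (1 - G) * (?m - m)) / m)"
    unfolding normed_sum_def by (simp only:)
  have G: "G = 1 - ?S / m"
    using nz by (simp add: GC_cdf_eq[OF real_distribution_law integrable_law p] diff_divide_distrib)
  have GC: "empirical_GC X n p \<omega> = 1 - ?T / ?m"
    using mean by (simp add: empirical_GC_eq[OF p] diff_divide_distrib)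
  \<comment> \<open>Both lower tails are written through the value at the same quantile, so the
    terms \<open>p * q\<close> and \<open>(1 - p) * q'\<close> cancel.\<close>
  have "a q - c = lower_tail law p - sample_lower_tail X n p \<omega> + ?R"
    "a q' - c' = lower_tail law (1 - p) - sample_lower_tail X n (1 - p) \<omega> + ?R'"
    using lower_tail_eq[OF real_distribution_law integrable_law p] lower_tail_eq[OF real_distribution_law integrable_law p']
    by (simp_all add: lower_tail_remainder_def a_def)
  then have "(a q' - c') + (a q - c) + (1 - G) * (?m - m) - (?R' + ?R) = ?S - ?T + ?S / m * (?m - m)"
    unfolding G by simp
  also have "\<dots> = ?S * ?m / m - ?T"
    using nz by (simp add: field_simps)
  finally have key: "(a q' - c') + (a q - c) + (1 - G) * (?m - m) - (?R' + ?R) = ?S * ?m / m - ?T" .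
  have "m / ?m * (normed_sum n \<omega> - (sqrt (real n) * ?R' + sqrt (real n) * ?R) / m)
      = sqrt (real n) * ((a q' - c') + (a q - c) + (1 - G) * (?m - m) - (?R' + ?R)) / ?m"
    unfolding sum using nz mean by (simp add: field_simps)
  also have "\<dots> = sqrt (real n) * (?S / m - ?T / ?m)"
    unfolding key using nz mean by (simp add: field_simps)
  also have "\<dots> = sqrt (real n) * (empirical_GC X n p \<omega> - G)"
    by (simp add: G GC)
  finally show ?thesis ..
qed

text \<open>The normed error differs from the normed sum of influences by
  \<open>m / sample_mean - 1\<close> times that sum, a null sequence times one bounded in L2, and by
  a bounded-in-probability multiple of the remainders. Slutsky's theorem then transfers the normal
  limit.\<close>

theorem weak_conv_empirical_GC:
  assumes cont: "isCont (quantile (cdf law)) p" "isCont (quantile (cdf law)) (1 - p)"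
  shows "tendsto_in_distribution M (\<lambda>n \<omega>. sqrt (real n) * (empirical_GC X n p \<omega> - G))
    (normal_distribution 0 (expectation (\<lambda>\<omega>. (influence (X 0 \<omega>))\<^sup>2)))"
proof -
  let ?Z = "\<lambda>n \<omega>. sqrt (real n) * (empirical_GC X n p \<omega> - G)"
  let ?B = "\<lambda>n \<omega>. (sqrt (real n) * lower_tail_remainder (1 - p) q' n \<omega> + sqrt (real n) * lower_tail_remainder p q n \<omega>) / m"
  note [measurable] = borel_measurable_empirical_GC[OF measurable_X p]
  have p': "0 < 1 - p" "1 - p < 1" using p by auto
  have B: "tendsto_in_probability M ?B (\<lambda>_. 0)"
    using tendsto_in_probability_isCont2[OF tendsto_lower_tail_remainder[OF p' cont(2)]
        tendsto_lower_tail_remainder[OF p cont(1)], of "\<lambda>z. (fst z + snd z) / m"] nz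
    by simp
  have "isCont (\<lambda>z. m / fst z - 1) (m, 0::real)"
    using nz by (intro continuous_intros) auto
  from tendsto_in_probability_isCont2[OF tendsto_sample_mean B this]
  have "tendsto_in_probability M (\<lambda>n \<omega>. m / sample_mean X n \<omega> - 1) (\<lambda>_. 0)"
    using nz by simp
  from tendsto_in_probability_mult_L2_bounded[OF this measurable_normed_sum integrable_normed_sum_square
      expectation_normed_sum_square_le]
  have UT: "tendsto_in_probability M (\<lambda>n \<omega>. (m / sample_mean X n \<omega> - 1) * normed_sum n \<omega>) (\<lambda>_. 0)" .
  have "isCont (\<lambda>z. m / fst z * snd z) (m, 0::real)"
    using nz by (intro continuous_intros) auto
  from tendsto_in_probability_isCont2[OF tendsto_sample_mean B this]
  have UB: "tendsto_in_probability M (\<lambda>n \<omega>. m / sample_mean X n \<omega> * ?B n \<omega>) (\<lambda>_. 0)"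
    by simp
  have diff: "tendsto_in_probability M
      (\<lambda>n \<omega>. (m / sample_mean X n \<omega> - 1) * normed_sum n \<omega> - m / sample_mean X n \<omega> * ?B n \<omega>) (\<lambda>_. 0)"
    using tendsto_in_probability_isCont2[OF UT UB, of "\<lambda>z. fst z - snd z"] by simp
  have "tendsto_in_probability M (\<lambda>n \<omega>. ?Z n \<omega> - normed_sum n \<omega>) (\<lambda>_. 0)"
  \<comment> \<open>The exact identity needs a nonzero sample mean, which holds once it is within
    \<open>\<bar>m\<bar> / 2\<close> of \<open>m\<close>.\<close>
  proof (rule tendsto_in_probability_cong_on_likely[OF diff tendsto_sample_mean])
    show "0 < \<bar>m\<bar> / 2" using nz by simp
    fix n :: nat and \<omega> assume n: "0 < n" and near: "\<bar>sample_mean X n \<omega> - m\<bar> \<le> \<bar>m\<bar> / 2"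
    have "sample_mean X n \<omega> \<noteq> 0" using near nz by auto
    from normed_empirical_GC_eq[OF n this]
    show "?Z n \<omega> - normed_sum n \<omega>
        = (m / sample_mean X n \<omega> - 1) * normed_sum n \<omega> - m / sample_mean X n \<omega> * ?B n \<omega>"
      by (simp only: right_diff_distrib left_diff_distrib mult_1)
  qed measurable
  moreover have "0 \<le> expectation (\<lambda>\<omega>. (influence (X 0 \<omega>))\<^sup>2)" by simp
  ultimately have "weak_conv_m (\<lambda>n. distr M borel (?Z n)) (normal_distribution 0 (expectation (\<lambda>\<omega>. (influence (X 0 \<omega>))\<^sup>2)))"
    by (intro weak_conv_m_distr_perturb[OF weak_conv_normed_sum] real_distribution_normal_distribution) measurable
  then show ?thesis
    by (simp add: tendsto_in_distribution_def)
qed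

end

end

theorem mainTheorem16:
  fixes M :: "'a measure"
    and X :: "nat \<Rightarrow> 'a \<Rightarrow> real"
    and F :: "real \<Rightarrow> real"
    and \<mu> p :: real
    and Y :: "'a \<Rightarrow> real"
  assumes "prob_space M"
    and "prob_space.indep_vars M (\<lambda>_. borel) X UNIV"
    and "\<And>i. distr M borel (X i) = distr M borel (X 0)"
    and "F = cdf (distr M borel (X 0))"
    and "integrable M (X 0)"
    and "\<mu> = (\<integral>\<omega>. X 0 \<omega> \<partial>M)"
    and "\<mu> \<noteq> 0"
    and "0 < p" and "p < 1"
    and "Y = (\<lambda>\<omega>. GC_influence F \<mu> p (X 0 \<omega>))"
  shows "tendsto_in_probability M (\<lambda>n. empirical_GC X n p) (\<lambda>_. GC F \<mu> p) \<and>
    (integrable M (\<lambda>\<omega>. (X 0 \<omega>)\<^sup>2) \<and>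
      isCont (quantile F) p \<and> isCont (quantile F) (1 - p) \<longrightarrow>
        integrable M Y \<and> (\<integral>\<omega>. Y \<omega> \<partial>M) = 0 \<and> integrable M (\<lambda>\<omega>. (Y \<omega>)\<^sup>2) \<and>
        tendsto_in_distribution M
          (\<lambda>n \<omega>. sqrt (real n) * (empirical_GC X n p \<omega> - GC F \<mu> p))
          (normal_distribution 0 (\<integral>\<omega>. (Y \<omega>)\<^sup>2 \<partial>M)))"
proof -
  interpret iid_sample M X
    using assms by (simp add: iid_sample_def iid_sample_axioms_def)
  have mean: "\<mu> = (\<integral>y. y \<partial>law)"
    using assms(6) integral_law_eq[of "\<lambda>y. y" 0] by simp
  have nz: "(\<integral>y. y \<partial>law) \<noteq> 0"
    using assms(7) mean by simp
  have F: "F = cdf law" by (rule assms(4))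
  note p = assms(8,9)
  show ?thesis
    unfolding assms(10) F mean
    using tendsto_empirical_GC[OF p nz] integrable_influence[OF p nz] expectation_influence[OF p nz]
      integrable_influence_square[OF p nz] weak_conv_empirical_GC[OF p nz]
    by blast
qed

end
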